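(* Let $0<p<\infty$ and $\alpha>-1$, and let $\mu$ be a positive Borel measure on $[0,1)$ such that: $\mu$ is a $\frac{2}{p}$-Carleson measure if $0<p\le 1$; $\mu$ is a $\frac{2-(p-1)^{2}}{p}$-Carleson measure if $1\le p\le 2$; and $\mu$ is a $\frac{1}{p}$-Carleson measure if $2<p<\infty$. Then the following statements are equivalent: (a) $\mathcal{H}_{\mu}^{\alpha}:A^{p}\to\mathcal{B}$ is bounded; (b) $\widetilde{\mathcal{I}}_{\mu_{\alpha+1}}:A^{p}\to\mathcal{B}$ is bounded; (c) $\mu$ is a $\left(\frac{2}{p}+\alpha+1\right)$-Carleson measure.
   Context: $\mathbb{D}$ is the open unit disk in $\mathbb{C}$, $H(\mathbb{D})$ is the space of analytic functions on $\mathbb{D}$, and $dA=\frac{dx\,dy}{\pi}$. For $0<p<\infty$, the Bergman space $A^{p}$ consists of all $f\in H(\mathbb{D})$ with $\|f\|_{A^{p}}=\left(\int_{\mathbb{D}}|f(z)|^{p}dA(z)\right)^{1/p}<\infty$. The Bloch space $\mathcal{B}$ consists of all $f\in H(\mathbb{D})$ with $\|f\|_{\mathcal{B}}=|f(0)|+\sup_{z\in\mathbb{D}}(1-|z|^{2})|f'(z)|<\infty$. For $s>0$, a positive Borel measure $\mu$ on $[0,1)$ is an $s$-Carleson measure if there is $M>0$ with $\mu([t,1))\le M(1-t)^{s}$ for all $0\le t<1$. Put $\mu_{n}=\int_{[0,1)}t^{n}d\mu(t)$ and $\mu_{n,k}=\mu_{n+k}$ for $n,k\ge 0$. For $\alpha>-1$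 and $f(z)=\sum_{k=0}^{\infty}a_{k}z^{k}\in H(\mathbb{D})$, define $$\mathcal{H}_{\mu}^{\alpha}(f)(z)=\sum_{n=0}^{\infty}\frac{\Gamma(n+1+\alpha)}{\Gamma(n+1)\Gamma(\alpha+1)}\left(\sum_{k=0}^{\infty}\mu_{n,k}a_{k}\right)z^{n},\quad z\in\mathbb{D},$$ whenever the inner series converge and the power series converges in $\mathbb{D}$, and define the sublinear operator $$\widetilde{\mathcal{I}}_{\mu_{\alpha+1}}(f)(z)=\int_{[0,1)}\frac{|f(t)|}{(1-tz)^{\alpha+1}}\,d\mu(t),\quad z\in\mathbb{D},$$ whenever the integral converges absolutely for every $z\in\mathbb{D}$. An operator $T:A^{p}\to\mathcal{B}$ (possibly only sublinear) is bounded if $T(f)$ is well defined (meaning, for $T=\mathcal{H}_{\mu}^{\alpha}$, that the series $\sum_{k=0}^{\infty}\mu_{n,k}a_{k}$ converges for every $n\ge 0$ and the power series defining $\mathcal{H}_{\mu}^{\alpha}(f)$ converges in $\mathbb{D}$, and, for $T=\widetilde{\mathcal{I}}_{\mu_{\alpha+1}}$, that the integral defining $\widetilde{\mathcal{I}}_{\mu_{\alpha+1}}(f)(z)$ converges absolutely for every $z\in\mathbb{D}$) and belongs to $\mathcal{B}$ for every $f\in A^{p}$, and there is $C>0$ with $\|T(f)\|_{\mathcal{B}}\le C\|f\|_{A^{p}}$ for all $f\in A^{p}$. *)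

theory Defs
  imports "HOL-Complex_Analysis.Complex_Analysis"
begin

text \<open>Analytic functions on the unit disk are total functions \<^typ>\<open>complex \<Rightarrow> complex\<close> that are
  holomorphic on \<^term>\<open>ball 0 1 :: complex set\<close>; nothing below depends on their values off the disk.\<close>

definition bergman :: "real \<Rightarrow> (complex \<Rightarrow> complex) set" where
  "bergman p = {f. f holomorphic_on ball 0 1 \<and>
     set_integrable lborel (ball 0 1) (\<lambda>z. norm (f z) powr p)}"

text \<open>The division by \<^term>\<open>pi\<close> is the normalisation \<open>dA = dx dy / pi\<close>.\<close>

definition bergman_norm :: "real \<Rightarrow> (complex \<Rightarrow> complex) \<Rightarrow> real" where
  "bergman_norm p f = ((LINT z:ball 0 1|lborel. norm (f z) powr p) / pi) powr (1 / p)"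

definition bloch :: "(complex \<Rightarrow> complex) set" where
  "bloch = {f. f holomorphic_on ball 0 1 \<and>
     bdd_above ((\<lambda>z. (1 - (norm z)\<^sup>2) * norm (deriv f z)) ` ball 0 1)}"

definition bloch_norm :: "(complex \<Rightarrow> complex) \<Rightarrow> real" where
  "bloch_norm f = norm (f 0) + (SUP z\<in>ball 0 1. (1 - (norm z)\<^sup>2) * norm (deriv f z))"

definition carleson :: "real \<Rightarrow> real measure \<Rightarrow> bool" where
  "carleson s \<mu> \<longleftrightarrow>
     (\<exists>M>0. \<forall>t\<in>{0..<1}. emeasure \<mu> {t..<1} \<le> ennreal (M * (1 - t) powr s))"

definition moment :: "real measure \<Rightarrow> nat \<Rightarrow> real" where
  "moment \<mu> n = (LINT t|\<mu>. t ^ n)"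

definition taylor_coeff :: "(complex \<Rightarrow> complex) \<Rightarrow> nat \<Rightarrow> complex" where
  "taylor_coeff f k = (deriv ^^ k) f 0 / fact k"

definition hankel_term ::
  "real measure \<Rightarrow> (complex \<Rightarrow> complex) \<Rightarrow> nat \<Rightarrow> nat \<Rightarrow> complex" where
  "hankel_term \<mu> f n k = of_real (moment \<mu> (n + k)) * taylor_coeff f k"

definition hankel_coeff ::
  "real measure \<Rightarrow> real \<Rightarrow> (complex \<Rightarrow> complex) \<Rightarrow> nat \<Rightarrow> complex" where
  "hankel_coeff \<mu> \<alpha> f n =
     of_real (Gamma (real n + 1 + \<alpha>) / (Gamma (real n + 1) * Gamma (\<alpha> + 1))) *
     (\<Sum>k. hankel_term \<mu> f n k)"

definition hankel_op ::
  "real measure \<Rightarrow> real \<Rightarrow> (complex \<Rightarrow> complex) \<Rightarrow> complex \<Rightarrow> complex" where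
  "hankel_op \<mu> \<alpha> f z = (\<Sum>n. hankel_coeff \<mu> \<alpha> f n * z ^ n)"

definition hankel_well_defined ::
  "real measure \<Rightarrow> real \<Rightarrow> (complex \<Rightarrow> complex) \<Rightarrow> bool" where
  "hankel_well_defined \<mu> \<alpha> f \<longleftrightarrow>
     (\<forall>n. summable (hankel_term \<mu> f n)) \<and>
     (\<forall>z\<in>ball 0 1. summable (\<lambda>n. hankel_coeff \<mu> \<alpha> f n * z ^ n))"

text \<open>For \<open>0 \<le> t < 1\<close> and \<open>z\<close> in the disk, \<open>1 - t z\<close> has positive real part, so the principal
  branch taken by \<open>powr\<close> is the intended one.\<close>

definition integral_kernel ::
  "real \<Rightarrow> (complex \<Rightarrow> complex) \<Rightarrow> complex \<Rightarrow> real \<Rightarrow> complex" where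
  "integral_kernel \<alpha> f z t =
     of_real (norm (f (of_real t))) / (1 - of_real t * z) powr of_real (\<alpha> + 1)"

definition integral_op ::
  "real measure \<Rightarrow> real \<Rightarrow> (complex \<Rightarrow> complex) \<Rightarrow> complex \<Rightarrow> complex" where
  "integral_op \<mu> \<alpha> f z = (LINT t|\<mu>. integral_kernel \<alpha> f z t)"

definition integral_well_defined ::
  "real measure \<Rightarrow> real \<Rightarrow> (complex \<Rightarrow> complex) \<Rightarrow> bool" where
  "integral_well_defined \<mu> \<alpha> f \<longleftrightarrow> (\<forall>z\<in>ball 0 1. integrable \<mu> (integral_kernel \<alpha> f z))"

text \<open>Since \<open>suminf\<close> and the Bochner integral are total, well-definedness of \<open>T f\<close> is a separate
  predicate \<open>wd f\<close>.\<close>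

definition bounded_bergman_bloch ::
  "real \<Rightarrow> ((complex \<Rightarrow> complex) \<Rightarrow> bool) \<Rightarrow>
   ((complex \<Rightarrow> complex) \<Rightarrow> complex \<Rightarrow> complex) \<Rightarrow> bool" where
  "bounded_bergman_bloch p wd T \<longleftrightarrow>
     (\<forall>f\<in>bergman p. wd f \<and> T f \<in> bloch) \<and>
     (\<exists>C>0. \<forall>f\<in>bergman p. bloch_norm (T f) \<le> C * bergman_norm p f)"

end

theory Submission
  imports Defs
begin

text \<open>Everything reduces to Taylor coefficients. Write \<open>c n\<close> for the coefficients of
  \<open>(1 - w) powr -(\<alpha> + 1)\<close>. If the rows of the Hankel matrix can be summed under
  the integral sign, then both operators turn \<open>f\<close> into a power series with coefficients
  \<open>c n * (\<integral> t ^ n * \<phi> t d\<mu>)\<close>, where \<open>\<phi> t\<close> is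
  \<open>f t\<close> for the Hankel operator and \<open>norm (f t)\<close> for the integral
  operator.

  Sufficiency of the Carleson condition. Point evaluation on the Bergman space satisfies
  \<open>norm (f z) \<le> C * bergman_norm p f * (1 - norm z) powr -(2/p)\<close>
  (\<open>bergman_growth\<close>). If \<open>\<mu>\<close> is
  \<open>(2/p + \<alpha> + 1)\<close>-Carleson, then
  \<open>\<integral> t ^ n * (1 - t) powr -(2/p) d\<mu>\<close> is at most a constant times
  \<open>fact n / Gamma (n + 2 + \<alpha>)\<close> (\<open>carleson_moment_bound\<close>), and in
  the product with \<open>c n\<close> the Gamma factors cancel except for
  \<open>1 / (n + 1 + \<alpha>)\<close>. So the coefficients of the image are \<open>O(1/n)\<close>,
  and such a series is a Bloch function because its derivative is dominated by a geometric series
  (\<open>bloch_of_coeffs\<close>).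

  Summation of the rows. For \<open>p > 2\<close> and \<open>\<alpha>\<close> close to
  \<open>-1\<close> the series \<open>\<Sum>k. moment \<mu> (n + k) * taylor_coeff f k\<close> need
  not converge absolutely, so estimates of single coefficients do not suffice. A contour integral
  bounds the partial sums \<open>\<Sum>k\<le>N. taylor_coeff f k\<close> by a multiple of
  \<open>(N + 1) powr b\<close> for every \<open>b > 2/p\<close>, because the kernel
  \<open>1 / (1 - u)\<close> costs only a logarithm; summation by parts turns this into a bound for
  the Taylor polynomials of \<open>f\<close> at \<open>t\<close> by \<open>(1 - t) powr -b\<close>,
  uniformly in \<open>N\<close>. Since \<open>b\<close> may be chosen below the Carleson exponent,
  dominated convergence applies (\<open>hankel_term_sums\<close>).

  Necessity. On the functions \<open>bergman_test p r\<close>, which are bounded in the Bergman norm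
  and positive on \<open>[0,1)\<close>, the two operators agree, so one argument serves both. Their
  images have nonnegative coefficients, bounded below by
  \<open>(1 - r\<^sup>2) powr -(2/p) * \<mu> [r,1) * r ^ n * c n\<close>; evaluating the derivative
  at \<open>z = r\<close> and comparing with the Bloch norm gives
  \<open>\<mu> [r,1) \<le> C * (1 - r) powr (2/p + \<alpha> + 1)\<close>
  (\<open>carleson_of_bounded\<close>). The a priori Carleson hypotheses enter through the
  finiteness of \<open>\<mu>\<close> and through some positive Carleson exponent, which is what
  justifies the series manipulations for the bounded test functions.\<close>

section \<open>Point evaluations on Bergman spaces\<close>

lemma measurable_Complex [measurable (raw)]:
  assumes "f \<in> borel_measurable M" "g \<in> borel_measurable M"
  shows "(\<lambda>x. Complex (f x) (g x)) \<in> borel_measurable M"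
proof -
  have "(\<lambda>x. complex_of_real (f x) + \<i> * complex_of_real (g x)) \<in> borel_measurable M"
    using assms by measurable
  then show ?thesis by (simp add: Complex_eq)
qed

lemma lborel_complex_eq_distr:
  "(lborel :: complex measure) = distr (lborel \<Otimes>\<^sub>M lborel) borel (\<lambda>v. Complex (fst v) (snd v))"
proof (rule lborel_eqI)
  fix l u :: complex assume "\<And>b. b \<in> Basis \<Longrightarrow> l \<bullet> b \<le> u \<bullet> b"
  then have le: "Re l \<le> Re u" "Im l \<le> Im u"
    by (force simp: Basis_complex_def)+
  have "emeasure (distr (lborel \<Otimes>\<^sub>M lborel) borel (\<lambda>v. Complex (fst v) (snd v))) (box l u)
      = emeasure (lborel \<Otimes>\<^sub>M lborel) ({Re l<..<Re u} \<times> {Im l<..<Im u})"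
    by (subst emeasure_distr)
       (auto simp: space_pair_measure in_box_complex_iff intro!: arg_cong2[where f=emeasure])
  also have "\<dots> = emeasure lborel {Re l<..<Re u} * emeasure lborel {Im l<..<Im u}"
    by (rule lborel.emeasure_pair_measure_Times) auto
  also have "\<dots> = (\<Prod>b\<in>Basis. (u - l) \<bullet> b)"
    using le by (simp add: Basis_complex_def ennreal_mult complex_eq_iff)
  finally show "emeasure (distr (lborel \<Otimes>\<^sub>M lborel) borel (\<lambda>v. Complex (fst v) (snd v))) (box l u)
      = (\<Prod>b\<in>Basis. (u - l) \<bullet> b)" .
qed simp

text \<open>Cartesian Tonelli on the complex plane. Averaging Cauchy's formula over squares instead of circles
  makes this enough for area estimates, without polar coordinates.\<close>

lemma nn_integral_lborel_complex:
  fixes f :: "complex \<Rightarrow> ennreal"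
  assumes [measurable]: "f \<in> borel_measurable borel"
  shows "(\<integral>\<^sup>+z. f z \<partial>lborel) = (\<integral>\<^sup>+x. \<integral>\<^sup>+y. f (Complex x y) \<partial>lborel \<partial>lborel)"
    and "(\<integral>\<^sup>+z. f z \<partial>lborel) = (\<integral>\<^sup>+y. \<integral>\<^sup>+x. f (Complex x y) \<partial>lborel \<partial>lborel)"
proof -
  have *: "(\<integral>\<^sup>+z. f z \<partial>lborel) = (\<integral>\<^sup>+v. f (Complex (fst v) (snd v)) \<partial>(lborel \<Otimes>\<^sub>M lborel))"
    by (subst lborel_complex_eq_distr) (rule nn_integral_distr; measurable)
  also have "\<dots> = (\<integral>\<^sup>+x. \<integral>\<^sup>+y. f (Complex x y) \<partial>lborel \<partial>lborel)"
    by (subst lborel.nn_integral_fst[symmetric]) auto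
  finally show "(\<integral>\<^sup>+z. f z \<partial>lborel) = (\<integral>\<^sup>+x. \<integral>\<^sup>+y. f (Complex x y) \<partial>lborel \<partial>lborel)" .
  show "(\<integral>\<^sup>+z. f z \<partial>lborel) = (\<integral>\<^sup>+y. \<integral>\<^sup>+x. f (Complex x y) \<partial>lborel \<partial>lborel)"
    unfolding * by (subst lborel.nn_integral_fst[symmetric]) (auto intro: lborel_pair.Fubini'[symmetric])
qed

lemma contour_integral_linepath_same_Im:
  assumes "Im z = c" "Im z' = c" "Re z = a" "Re z' = b" "a < b"
  shows "contour_integral (linepath z z') f = integral {a..b} (\<lambda>x. f (Complex x c))"
proof -
  have zz': "z = Complex a c" "z' = Complex b c"
    using assms by (auto simp: complex_eq_iff)
  have "contour_integral (linepath z z') f = (z' - z) * integral {0..1} (\<lambda>x. f (linepath z z' x))"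
    by (simp add: contour_integral_integral)
  also have "z' - z = of_real (b - a)"
    by (simp add: zz' Complex_eq algebra_simps)
  also have "integral {0..1} (\<lambda>x. f (linepath z z' x))
      = integral {0..(b - a) / (b - a)} (\<lambda>x. f (Complex (a + (b - a) * x) c))"
    using \<open>a < b\<close> by (simp add: linepath_def Complex_eq scaleR_conv_of_real algebra_simps zz')
  also have "{0..(b - a) / (b - a)} = (\<lambda>x. x / (b - a)) ` {0..b - a}"
    using \<open>a < b\<close> by simp
  also have "integral \<dots> (\<lambda>x. f (Complex (a + (b - a) * x) c)) =
             integral {a-a..b-a} (\<lambda>x. f (Complex (x + a) c)) / of_real (b - a)"
    using \<open>a < b\<close> by (subst integral_stretch_real) (auto simp: scaleR_conv_of_real add_ac)
  also have "\<dots> = integral {a..b} (\<lambda>x. f (Complex x c)) / of_real (b - a)"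
    by (subst integral_shift_real_ivl) (rule refl)
  finally show ?thesis
    using \<open>a < b\<close> by simp
qed

text \<open>Passing to nonnegative integrals lets the later averaging over squares go through without any
  integrability side conditions.\<close>

lemma norm_integral_le_nn_integral:
  fixes g :: "real \<Rightarrow> complex"
  assumes "continuous_on {a..b} g" 
  shows "ennreal (norm (integral {a..b} g)) \<le> (\<integral>\<^sup>+x. ennreal (norm (g x)) * indicator {a..b} x \<partial>lborel)"
proof -
  have "set_integrable lborel {a..b} g"
    using borel_integrable_compact[OF compact_Icc assms] by (simp add: set_integrable_def)
  then have "integral {a..b} g = (LINT x:{a..b}|lborel. g x)" "integrable lborel (\<lambda>x. indicator {a..b} x *\<^sub>R g x)"
    by (auto simp: set_borel_integral_eq_integral set_integrable_def)
  then have "ennreal (norm (integral {a..b} g)) \<le> (\<integral>\<^sup>+x. ennreal (norm (indicator {a..b} x *\<^sub>R g x)) \<partial>lborel)"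
    using integral_norm_bound_ennreal[of lborel "\<lambda>x. indicator {a..b} x *\<^sub>R g x"]
    by (simp add: set_lebesgue_integral_def)
  also have "\<dots> = (\<integral>\<^sup>+x. ennreal (norm (g x)) * indicator {a..b} x \<partial>lborel)"
    by (intro nn_integral_cong) (auto split: split_indicator)
  finally show ?thesis .
qed

text \<open>Cauchy's formula on the boundary of the square of half-side \<open>r\<close> about
  \<open>z\<close>: on that boundary \<open>norm (w - z) \<ge> r\<close>, so the kernel costs a
  factor \<open>1 / r\<close>.\<close>

lemma Cauchy_square_bound:
  fixes f :: "complex \<Rightarrow> complex"
  assumes f: "f holomorphic_on S" and S: "open S" "convex S" and r: "r > 0"
    and sub: "cbox (Complex (x - r) (y - r)) (Complex (x + r) (y + r)) \<subseteq> S"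
  shows "ennreal (2 * pi * r * norm (f (Complex x y))) \<le>
      (\<integral>\<^sup>+u. ennreal (norm (f (Complex u (y - r)))) * indicator {x-r..x+r} u \<partial>lborel) +
      (\<integral>\<^sup>+u. ennreal (norm (f (Complex u (y + r)))) * indicator {x-r..x+r} u \<partial>lborel) +
      (\<integral>\<^sup>+v. ennreal (norm (f (Complex (x - r) v))) * indicator {y-r..y+r} v \<partial>lborel) +
      (\<integral>\<^sup>+v. ennreal (norm (f (Complex (x + r) v))) * indicator {y-r..y+r} v \<partial>lborel)"
proof -
  define z where "z = Complex x y"
  define g where "g = (\<lambda>w. f w / (w - z))"
  define a1 a2 a3 a4 where "a1 = Complex (x - r) (y - r)" and "a2 = Complex (x + r) (y - r)"
    and "a3 = Complex (x + r) (y + r)" and "a4 = Complex (x - r) (y + r)"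
  note a_defs = a1_def a2_def a3_def a4_def
  let ?R = "rectpath a1 a3"
  have R: "?R = linepath a1 a2 +++ linepath a2 a3 +++ linepath a3 a4 +++ linepath a4 a1"
    by (simp add: rectpath_def a_defs Let_def)
  have z_box: "z \<in> box a1 a3"
    using r by (simp add: z_def a_defs in_box_complex_iff)
  have im: "path_image ?R \<subseteq> S - {z}"
    using z_box sub path_image_rectpath_cbox_minus_box[of a1 a3] r
    by (auto simp: a_defs)
  have zS: "z \<in> interior S"
    using z_box sub S box_subset_cbox[of a1 a3] by (auto simp: a_defs interior_open)
  have w: "winding_number ?R z = 1"
    using z_box r by (intro winding_number_rectpath) auto
  have I: "(g has_contour_integral (2 * pi * \<i> * f z)) ?R"
    using Cauchy_integral_formula_convex_simple[OF S(2) f zS _ im] w by (simp add: g_def)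
  have cont: "continuous_on (S - {z}) g"
    unfolding g_def using f by (intro continuous_intros holomorphic_on_imp_continuous_on)
      (auto intro: holomorphic_on_subset)
  have segs: "closed_segment a1 a2 \<subseteq> S - {z}" "closed_segment a2 a3 \<subseteq> S - {z}"
     "closed_segment a3 a4 \<subseteq> S - {z}" "closed_segment a4 a1 \<subseteq> S - {z}"
    using im unfolding R by (auto simp: path_image_join)
  have int: "g contour_integrable_on linepath a1 a2" "g contour_integrable_on linepath a2 a3"
    "g contour_integrable_on linepath a3 a4" "g contour_integrable_on linepath a4 a1"
    using segs by (auto intro!: contour_integrable_continuous_linepath intro: continuous_on_subset[OF cont])
  have eq: "2 * pi * \<i> * f z = contour_integral (linepath a1 a2) g + contour_integral (linepath a2 a3) g
     + contour_integral (linepath a3 a4) g + contour_integral (linepath a4 a1) g"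
    using contour_integral_unique[OF I] int unfolding R by (simp add: algebra_simps)
  have le: "2 * pi * norm (f z) \<le> norm (contour_integral (linepath a1 a2) g) + norm (contour_integral (linepath a2 a3) g)
     + norm (contour_integral (linepath a3 a4) g) + norm (contour_integral (linepath a4 a1) g)"
  proof -
    have "2 * pi * norm (f z) = norm (2 * pi * \<i> * f z)" by (simp add: norm_mult)
    also have "\<dots> \<le> norm (contour_integral (linepath a1 a2) g) + norm (contour_integral (linepath a2 a3) g)
     + norm (contour_integral (linepath a3 a4) g) + norm (contour_integral (linepath a4 a1) g)"
      unfolding eq by (intro norm_triangle_le add_mono order.refl)
    finally show ?thesis .
  qed
  have horizontal: "ennreal (r * norm (integral {x-r..x+r} (\<lambda>u. g (Complex u c))))
      \<le> (\<integral>\<^sup>+u. ennreal (norm (f (Complex u c))) * indicator {x-r..x+r} u \<partial>lborel)"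
    if c: "c = y - r \<or> c = y + r" for c
  proof -
    have "continuous_on {x-r..x+r} (\<lambda>u. g (Complex u c))"
    proof (rule continuous_on_compose2[OF cont])
      show "continuous_on {x-r..x+r} (\<lambda>u. Complex u c)"
        by (intro continuous_intros)
      show "(\<lambda>u. Complex u c) ` {x-r..x+r} \<subseteq> S - {z}"
        using sub c r by (auto simp: z_def subset_iff in_cbox_complex_iff)
    qed
    then have "ennreal (norm (integral {x-r..x+r} (\<lambda>u. of_real r * g (Complex u c))))
        \<le> (\<integral>\<^sup>+u. ennreal (norm (of_real r * g (Complex u c))) * indicator {x-r..x+r} u \<partial>lborel)"
      by (intro norm_integral_le_nn_integral continuous_intros)
    also have "\<dots> \<le> (\<integral>\<^sup>+u. ennreal (norm (f (Complex u c))) * indicator {x-r..x+r} u \<partial>lborel)"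
    proof (intro nn_integral_mono mult_right_mono ennreal_leI)
      fix u
      have "r \<le> \<bar>Im (Complex u c - z)\<bar>" using c r by (auto simp: z_def)
      also have "\<dots> \<le> norm (Complex u c - z)" by (rule abs_Im_le_cmod)
      finally show "norm (of_real r * g (Complex u c)) \<le> norm (f (Complex u c))"
        unfolding g_def norm_divide norm_mult using r
        by (auto simp: divide_le_eq mult.commute[of "norm (f _)"] intro: mult_right_mono)
    qed simp
    finally show ?thesis using r by (simp add: norm_mult)
  qed
  have vertical: "ennreal (r * norm (integral {y-r..y+r} (\<lambda>v. g (Complex c v))))
      \<le> (\<integral>\<^sup>+v. ennreal (norm (f (Complex c v))) * indicator {y-r..y+r} v \<partial>lborel)"
    if c: "c = x - r \<or> c = x + r" for c
  proof -
    have "continuous_on {y-r..y+r} (\<lambda>v. g (Complex c v))"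
    proof (rule continuous_on_compose2[OF cont])
      show "continuous_on {y-r..y+r} (\<lambda>v. Complex c v)"
        by (intro continuous_intros)
      show "(\<lambda>v. Complex c v) ` {y-r..y+r} \<subseteq> S - {z}"
        using sub c r by (auto simp: z_def subset_iff in_cbox_complex_iff)
    qed
    then have "ennreal (norm (integral {y-r..y+r} (\<lambda>v. of_real r * g (Complex c v))))
        \<le> (\<integral>\<^sup>+v. ennreal (norm (of_real r * g (Complex c v))) * indicator {y-r..y+r} v \<partial>lborel)"
      by (intro norm_integral_le_nn_integral continuous_intros)
    also have "\<dots> \<le> (\<integral>\<^sup>+v. ennreal (norm (f (Complex c v))) * indicator {y-r..y+r} v \<partial>lborel)"
    proof (intro nn_integral_mono mult_right_mono ennreal_leI)
      fix v
      have "r \<le> \<bar>Re (Complex c v - z)\<bar>" using c r by (auto simp: z_def)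
      also have "\<dots> \<le> norm (Complex c v - z)" by (rule abs_Re_le_cmod)
      finally show "norm (of_real r * g (Complex c v)) \<le> norm (f (Complex c v))"
        unfolding g_def norm_divide norm_mult using r
        by (auto simp: divide_le_eq mult.commute[of "norm (f _)"] intro: mult_right_mono)
    qed simp
    finally show ?thesis using r by (simp add: norm_mult)
  qed
  have sides:
    "norm (contour_integral (linepath a1 a2) g) = norm (integral {x-r..x+r} (\<lambda>u. g (Complex u (y - r))))"
    "norm (contour_integral (linepath a3 a4) g) = norm (integral {x-r..x+r} (\<lambda>u. g (Complex u (y + r))))"
    "norm (contour_integral (linepath a4 a1) g) = norm (integral {y-r..y+r} (\<lambda>v. g (Complex (x - r) v)))"
    "norm (contour_integral (linepath a2 a3) g) = norm (integral {y-r..y+r} (\<lambda>v. g (Complex (x + r) v)))"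
    using r contour_integral_linepath_same_Im[of a1 "y - r" a2 "x - r" "x + r" g]
      contour_integral_linepath_same_Im[of a4 "y + r" a3 "x - r" "x + r" g]
      contour_integral_linepath_same_Re[of a1 "x - r" a4 "y - r" "y + r" g]
      contour_integral_linepath_same_Re[of a2 "x + r" a3 "y - r" "y + r" g]
      contour_integral_reverse_linepath[of a3 a4 g] contour_integral_reverse_linepath[of a4 a1 g]
      int(3,4) segs
    by (simp_all add: a_defs norm_mult contour_integral_reverse_linepath continuous_on_subset[OF cont]
         contour_integrable_continuous_linepath)
  have "ennreal (2 * pi * r * norm (f z)) = ennreal (r * (2 * pi * norm (f z)))"
    by (simp add: mult_ac)
  also have "\<dots> \<le> ennreal (r * (norm (contour_integral (linepath a1 a2) g) + norm (contour_integral (linepath a2 a3) g)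
     + norm (contour_integral (linepath a3 a4) g) + norm (contour_integral (linepath a4 a1) g)))"
    using le r by (intro ennreal_leI mult_left_mono) auto
  also have "\<dots> = ennreal (r * norm (contour_integral (linepath a1 a2) g)) +
      ennreal (r * norm (contour_integral (linepath a3 a4) g)) +
      ennreal (r * norm (contour_integral (linepath a4 a1) g)) +
      ennreal (r * norm (contour_integral (linepath a2 a3) g))"
    using r by (simp add: ring_distribs add_ac flip: ennreal_plus)
  also have "\<dots> \<le>
      (\<integral>\<^sup>+u. ennreal (norm (f (Complex u (y - r)))) * indicator {x-r..x+r} u \<partial>lborel) +
      (\<integral>\<^sup>+u. ennreal (norm (f (Complex u (y + r)))) * indicator {x-r..x+r} u \<partial>lborel) +
      (\<integral>\<^sup>+v. ennreal (norm (f (Complex (x - r) v))) * indicator {y-r..y+r} v \<partial>lborel) +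
      (\<integral>\<^sup>+v. ennreal (norm (f (Complex (x + r) v))) * indicator {y-r..y+r} v \<partial>lborel)"
    unfolding sides by (intro add_mono horizontal vertical) auto
  finally show ?thesis by (simp add: z_def)
qed

text \<open>A mean value inequality over area, with a constant that makes no attempt at being sharp. The
  boundary estimate is integrated over all half-sides in \<open>[r/2, r]\<close>; each of the four
  sides then sweeps out part of the square, and Tonelli identifies the resulting double integral
  with an area integral.\<close>

lemma area_mean_value_square:
  fixes f :: "complex \<Rightarrow> complex"
  assumes f: "f holomorphic_on S" and S: "open S" "convex S" and r: "r > 0"
    and sub: "cbox (Complex (x - r) (y - r)) (Complex (x + r) (y + r)) \<subseteq> S"
  shows "ennreal (r\<^sup>2 * norm (f (Complex x y))) \<le>
    4 * (\<integral>\<^sup>+z. ennreal (norm (f z)) * indicator (cbox (Complex (x - r) (y - r)) (Complex (x + r) (y + r))) z \<partial>lborel)"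
proof -
  define Q where "Q = cbox (Complex (x - r) (y - r)) (Complex (x + r) (y + r))"
  define F where "F = (\<lambda>z. ennreal (norm (f z)) * indicator Q z)"
  have "(\<lambda>z. if z \<in> Q then f z else 0) \<in> borel_measurable borel"
    unfolding Q_def
    using f sub by (intro borel_measurable_continuous_on_if)
      (auto intro!: continuous_intros holomorphic_on_imp_continuous_on intro: holomorphic_on_subset)
  then have "(\<lambda>z. ennreal (norm (if z \<in> Q then f z else 0))) \<in> borel_measurable borel"
    by measurable
  also have "(\<lambda>z. ennreal (norm (if z \<in> Q then f z else 0))) = F"
    by (auto simp: F_def)
  finally have [measurable]: "F \<in> borel_measurable borel" .
  define A B where "A = (\<lambda>v. \<integral>\<^sup>+u. F (Complex u v) \<partial>lborel)" and "B = (\<lambda>u. \<integral>\<^sup>+v. F (Complex u v) \<partial>lborel)"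
  have [measurable]: "A \<in> borel_measurable borel" "B \<in> borel_measurable borel"
    unfolding A_def B_def by measurable
  have AB: "integral\<^sup>N lborel F = integral\<^sup>N lborel A" "integral\<^sup>N lborel F = integral\<^sup>N lborel B"
    unfolding A_def B_def by (rule nn_integral_lborel_complex; measurable)+
  have le: "ennreal (pi * r * norm (f (Complex x y))) \<le> A (y - \<rho>) + A (y + \<rho>) + B (x - \<rho>) + B (x + \<rho>)"
    if \<rho>: "r / 2 \<le> \<rho>" "\<rho> \<le> r" for \<rho>
  proof -
    have "cbox (Complex (x - \<rho>) (y - \<rho>)) (Complex (x + \<rho>) (y + \<rho>)) \<subseteq> Q"
      using \<rho> r by (auto simp: Q_def subset_iff in_cbox_complex_iff)
    then have sub': "cbox (Complex (x - \<rho>) (y - \<rho>)) (Complex (x + \<rho>) (y + \<rho>)) \<subseteq> S"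
      using sub by (simp add: Q_def)
    have "ennreal (pi * r * norm (f (Complex x y))) \<le> ennreal (2 * pi * \<rho> * norm (f (Complex x y)))"
      using \<rho> by (intro ennreal_leI mult_right_mono) auto
    also have "\<dots> \<le> 
      (\<integral>\<^sup>+u. ennreal (norm (f (Complex u (y - \<rho>)))) * indicator {x-\<rho>..x+\<rho>} u \<partial>lborel) +
      (\<integral>\<^sup>+u. ennreal (norm (f (Complex u (y + \<rho>)))) * indicator {x-\<rho>..x+\<rho>} u \<partial>lborel) +
      (\<integral>\<^sup>+v. ennreal (norm (f (Complex (x - \<rho>) v))) * indicator {y-\<rho>..y+\<rho>} v \<partial>lborel) +
      (\<integral>\<^sup>+v. ennreal (norm (f (Complex (x + \<rho>) v))) * indicator {y-\<rho>..y+\<rho>} v \<partial>lborel)"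
      using \<rho> r by (intro Cauchy_square_bound[OF f S _ sub']) auto
    also have "\<dots> \<le> A (y - \<rho>) + A (y + \<rho>) + B (x - \<rho>) + B (x + \<rho>)"
      unfolding A_def B_def F_def using \<rho> r
      by (intro add_mono nn_integral_mono mult_left_mono)
         (auto simp: Q_def in_cbox_complex_iff split: split_indicator)
    finally show ?thesis .
  qed
  have shift: "(\<integral>\<^sup>+\<rho>. h (t + c * \<rho>) \<partial>lborel) = integral\<^sup>N lborel h"
    if [measurable]: "h \<in> borel_measurable borel" and "c = 1 \<or> c = -1" for h and t c :: real
    using nn_integral_real_affine[of h c t] that by auto
  have shiftA: "(\<integral>\<^sup>+\<rho>. A (y - \<rho>) \<partial>lborel) = integral\<^sup>N lborel F" "(\<integral>\<^sup>+\<rho>. A (y + \<rho>) \<partial>lborel) = integral\<^sup>N lborel F"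
     "(\<integral>\<^sup>+\<rho>. B (x - \<rho>) \<partial>lborel) = integral\<^sup>N lborel F" "(\<integral>\<^sup>+\<rho>. B (x + \<rho>) \<partial>lborel) = integral\<^sup>N lborel F"
    using shift[of A "-1" y] shift[of A 1 y] shift[of B "-1" x] shift[of B 1 x] AB by auto
  have "ennreal (pi * r * norm (f (Complex x y))) * ennreal (r / 2)
      = (\<integral>\<^sup>+\<rho>. ennreal (pi * r * norm (f (Complex x y))) * indicator {r/2..r} \<rho> \<partial>lborel)"
    using r by (simp add: nn_integral_cmult_indicator)
  also have "\<dots> \<le> (\<integral>\<^sup>+\<rho>. A (y - \<rho>) + A (y + \<rho>) + B (x - \<rho>) + B (x + \<rho>) \<partial>lborel)"
    using le by (intro nn_integral_mono) (auto split: split_indicator)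
  also have "\<dots> = 4 * integral\<^sup>N lborel F"
  proof -
    have "a + a + a + a = 4 * a" for a :: ennreal
      using distrib_right[of 2 2 a] by (simp add: mult_2 add.assoc)
    then show ?thesis
      by (simp add: nn_integral_add shiftA)
  qed
  finally have "ennreal (pi * r * norm (f (Complex x y))) * ennreal (r / 2) \<le> 4 * integral\<^sup>N lborel F" .
  moreover have "ennreal (r\<^sup>2 * norm (f (Complex x y))) \<le> ennreal (pi * r * norm (f (Complex x y))) * ennreal (r / 2)"
    using r pi_ge_two mult_right_mono[of 2 pi "r\<^sup>2 * norm (f (Complex x y))"]
    by (auto simp flip: ennreal_mult intro!: ennreal_leI simp: power2_eq_square mult_ac)
  ultimately show ?thesis by (simp add: F_def Q_def)
qed

text \<open>A substitute for Jensen's inequality that works for all \<open>p > 0\<close>: a value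
  \<open>x\<close> comparable to \<open>a\<close> is either a small fraction of \<open>a\<close>,
  which can be absorbed later, or is controlled by \<open>x powr p\<close>. The fraction
  \<open>1/32\<close> is what the constant in the mean value inequality can absorb, and
  \<open>2 powr (2/p)\<close> is the oscillation that occurs near a weighted maximum.\<close>

lemma le_fraction_plus_powr:
  fixes a x p :: real
  assumes "a > 0" "x \<ge> 0" "p > 0" "x \<le> 2 powr (2 / p) * a"
  shows "x \<le> a / 32 + (2 powr (2 / p) * 32 powr p) * a powr (1 - p) * x powr p"
proof (cases "x \<le> a / 32")
  case True
  have "0 \<le> (2 powr (2 / p) * 32 powr p) * a powr (1 - p) * x powr p"
    using assms by simp
  with True show ?thesis by linarith
next
  case False
  have "a powr p = (32 * (a / 32)) powr p" by simp
  also have "\<dots> = 32 powr p * (a / 32) powr p"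
    using assms by (subst powr_mult) auto
  also have "\<dots> \<le> 32 powr p * x powr p"
    using False assms by (intro mult_left_mono powr_mono2) auto
  finally have "a powr p \<le> 32 powr p * x powr p" .
  then have "a powr (1 - p) * a powr p \<le> a powr (1 - p) * (32 powr p * x powr p)"
    by (intro mult_left_mono) auto
  moreover have "a powr (1 - p) * a powr p = a"
    using assms by (simp flip: powr_add)
  ultimately have "a \<le> 32 powr p * a powr (1 - p) * x powr p" by (simp add: mult_ac)
  then have *: "2 powr (2 / p) * a \<le> 2 powr (2 / p) * (32 powr p * a powr (1 - p) * x powr p)"
    by (intro mult_left_mono) auto
  have "x \<le> (2 powr (2 / p) * 32 powr p) * a powr (1 - p) * x powr p"
    using order_trans[OF assms(4) *] by (simp only: mult.assoc)
  then show ?thesis using assms(1) by linarith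
qed

text \<open>Subharmonicity of \<open>norm f powr p\<close> is avoided by looking at a maximum point
  \<open>z0\<close> of \<open>(R - norm z)\<^sup>2 * norm (f z) powr p\<close>. On a square about
  \<open>z0\<close> of size comparable to \<open>R - norm z0\<close> the maximality forces
  \<open>norm (f w) \<le> 2 powr (2/p) * norm (f z0)\<close>, so the mean value inequality for the
  first power of \<open>f\<close> implies one for its \<open>p\<close>-th power.\<close>

lemma bergman_growth_subdisk:
  fixes f :: "complex \<Rightarrow> complex"
  assumes p: "p > 0" and f: "f holomorphic_on ball 0 1"
    and int: "set_integrable lborel (ball 0 1) (\<lambda>z. norm (f z) powr p)"
    and R: "R < 1" and z: "norm z < R"
  shows "(R - norm z)\<^sup>2 * norm (f z) powr p
    \<le> 128 * (2 powr (2 / p) * 32 powr p) * (LINT z:ball 0 1|lborel. norm (f z) powr p)"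
proof -
  define K where "K = 2 powr (2 / p) * 32 powr p"
  define F where "F = (LINT z:ball 0 1|lborel. norm (f z) powr p)"
  have F0: "F \<ge> 0" unfolding F_def set_lebesgue_integral_def by (rule Bochner_Integration.integral_nonneg) auto
  have K0: "K > 0" by (simp add: K_def)
  have "R > 0" using z norm_ge_zero[of z] by linarith
  define h where "h = (\<lambda>w. (R - norm w)\<^sup>2 * norm (f w) powr p)"
  have "continuous_on (cball 0 R) h"
    unfolding h_def using f R p
    by (intro continuous_intros continuous_on_powr' holomorphic_on_imp_continuous_on)
       (auto intro: holomorphic_on_subset)
  then obtain z0 where z0: "z0 \<in> cball 0 R" and max: "\<And>w. w \<in> cball 0 R \<Longrightarrow> h w \<le> h z0"
    using continuous_attains_sup[of "cball 0 R" h] \<open>R > 0\<close> by auto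
  have "h z0 \<le> 128 * K * F"
  proof (cases "norm z0 = R \<or> f z0 = 0")
    case True
    then have "h z0 = 0" by (auto simp: h_def)
    then show ?thesis using F0 K0 by simp
  next
    case False
    define a where "a = norm (f z0)"
    have a: "a > 0" using False by (simp add: a_def)
    \<comment> \<open>A square of half-side \<open>r\<close> has diagonal radius below \<open>2 * r\<close>, so it stays at distance at least
      half of \<open>R - norm z0\<close> from the circle of radius \<open>R\<close>.\<close>
    define r where "r = (R - norm z0) / 4"
    have r: "r > 0" using False z0 by (simp add: r_def)
    define Q where "Q = cbox (Complex (Re z0 - r) (Im z0 - r)) (Complex (Re z0 + r) (Im z0 + r))"
    have Q: "norm w \<le> norm z0 + 2 * r" if "w \<in> Q" for w
    proof -
      have "norm (w - z0) \<le> \<bar>Re (w - z0)\<bar> + \<bar>Im (w - z0)\<bar>" by (rule cmod_le)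
      also have "\<dots> \<le> 2 * r" using that by (auto simp: Q_def in_cbox_complex_iff)
      finally show ?thesis using norm_triangle_sub[of w z0] by simp
    qed
    have QR: "norm w \<le> R - 2 * r" if "w \<in> Q" for w
    proof -
      have "4 * r = R - norm z0" by (simp add: r_def)
      then show ?thesis using Q[OF that] by linarith
    qed
    have fQ: "norm (f w) \<le> 2 powr (2 / p) * a" if "w \<in> Q" for w
    proof -
      have "(2 * r)\<^sup>2 * norm (f w) powr p \<le> h w"
        unfolding h_def using QR[OF that] r by (intro mult_right_mono power_mono) auto
      also have "\<dots> \<le> h z0" using QR[OF that] r by (intro max) auto
      also have "\<dots> = (2 * r)\<^sup>2 * (4 * a powr p)"
        by (simp add: h_def a_def r_def power2_eq_square algebra_simps)
      finally have "norm (f w) powr p \<le> 4 * a powr p" using r by simp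
      also have "\<dots> = (2 powr (2 / p) * a) powr p"
        using a p by (simp add: powr_mult powr_powr)
      finally show ?thesis
        using powr_less_mono2[OF p, of "2 powr (2 / p) * a" "norm (f w)"] a by force
    qed
    define G where "G = (\<lambda>w. indicator (ball 0 1) w *\<^sub>R norm (f w) powr p)"
    have G: "integrable lborel G" using int by (simp add: G_def set_integrable_def)
    have [measurable]: "G \<in> borel_measurable borel"
      using borel_measurable_integrable[OF G] by simp
    have Gint: "(\<integral>\<^sup>+w. ennreal (G w) \<partial>lborel) = ennreal F"
      using nn_integral_eq_integral[OF G] by (simp add: G_def F_def set_lebesgue_integral_def)
    have Qball: "Q \<subseteq> ball 0 1" using QR r R by fastforce
    have [measurable]: "Q \<in> sets borel" by (simp add: Q_def)
    have emQ: "emeasure lborel Q = ennreal (4 * r\<^sup>2)"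
      unfolding Q_def using r
      by (subst emeasure_lborel_cbox) (auto simp: Basis_complex_def inner_complex_def complex_eq_iff power2_eq_square)
    have "ennreal (r\<^sup>2 * a) \<le> 4 * (\<integral>\<^sup>+w. ennreal (norm (f w)) * indicator Q w \<partial>lborel)"
      using area_mean_value_square[OF f _ _ r, of "Re z0" "Im z0"] Qball
      by (simp add: Q_def a_def)
    also have "\<dots> \<le> 4 * (\<integral>\<^sup>+w. ennreal (a / 32) * indicator Q w + ennreal (K * a powr (1 - p)) * ennreal (G w) \<partial>lborel)"
    proof (intro mult_left_mono nn_integral_mono)
      fix w
      show "ennreal (norm (f w)) * indicator Q w \<le>
          ennreal (a / 32) * indicator Q w + ennreal (K * a powr (1 - p)) * ennreal (G w)"
      proof (cases "w \<in> Q")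
        case True
        then have "norm (f w) \<le> a / 32 + K * a powr (1 - p) * norm (f w) powr p"
          unfolding K_def using le_fraction_plus_powr[OF a _ p fQ] by simp
        then have "ennreal (norm (f w)) \<le> ennreal (a / 32 + K * a powr (1 - p) * G w)"
          using True Qball by (intro ennreal_leI) (auto simp: G_def)
        also have "\<dots> = ennreal (a / 32) + ennreal (K * a powr (1 - p)) * ennreal (G w)"
          using a K0 by (subst ennreal_plus) (auto simp: G_def ennreal_mult)
        finally show ?thesis using True by simp
      qed simp
    qed simp
    also have "\<dots> = 4 * (ennreal (a / 32) * ennreal (4 * r\<^sup>2) + ennreal (K * a powr (1 - p)) * ennreal F)"
      by (simp add: nn_integral_add nn_integral_cmult emQ Gint)
    also have "\<dots> = ennreal (4 * (a / 32 * (4 * r\<^sup>2) + K * a powr (1 - p) * F))"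
    proof -
      have "4 * (ennreal X + ennreal Y) = ennreal (4 * (X + Y))" if "X \<ge> 0" "Y \<ge> 0" for X Y
        using that by (subst ennreal_mult) auto
      moreover have "ennreal (a / 32) * ennreal (4 * r\<^sup>2) = ennreal (a / 32 * (4 * r\<^sup>2))"
        "ennreal (K * a powr (1 - p)) * ennreal F = ennreal (K * a powr (1 - p) * F)"
        using a K0 F0 by (intro ennreal_mult[symmetric]; simp)+
      ultimately show ?thesis using a K0 F0 by simp
    qed
    finally have "r\<^sup>2 * a \<le> 4 * (a / 32 * (4 * r\<^sup>2) + K * a powr (1 - p) * F)"
      using a K0 F0 by (subst (asm) ennreal_le_iff) auto
    \<comment> \<open>The share of the fraction \<open>a / 32\<close> amounts to half of the left-hand side and is absorbed there.\<close>
    then have "r\<^sup>2 * a \<le> 8 * K * F * a powr (1 - p)" by (simp add: algebra_simps)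
    then have "r\<^sup>2 * a * a powr (p - 1) \<le> 8 * K * F * a powr (1 - p) * a powr (p - 1)"
      by (intro mult_right_mono) auto
    moreover have "a * a powr (p - 1) = a powr p" "a powr (1 - p) * a powr (p - 1) = 1"
      using a powr_add[of a 1 "p - 1"] by (simp_all flip: powr_add)
    ultimately have "r\<^sup>2 * a powr p \<le> 8 * K * F" by (simp add: mult.assoc)
    then show ?thesis
      by (simp add: h_def a_def r_def power_divide)
  qed
  moreover have "h z \<le> h z0" using z by (intro max) auto
  ultimately show ?thesis by (simp add: h_def K_def F_def)
qed

text \<open>The radius \<open>R < 1\<close> only serves to have a maximum available; the bound on the smaller
  disk does not depend on it, and \<open>R\<close> tends to \<open>1\<close>.\<close>

lemma bergman_growth:
  assumes p: "p > 0"
  obtains C where "C > 0"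
    "\<And>f z. f \<in> bergman p \<Longrightarrow> norm z < 1 \<Longrightarrow> norm (f z) \<le> C * bergman_norm p f * (1 - norm z) powr (-(2 / p))"
proof
  define K where "K = 128 * (2 powr (2 / p) * 32 powr p) * pi"
  have K: "K > 0" by (simp add: K_def)
  then show "K powr (1 / p) > 0" by simp
  fix f :: "complex \<Rightarrow> complex" and z :: complex assume f: "f \<in> bergman p" and z: "norm z < 1"
  define F where "F = (LINT z:ball 0 1|lborel. norm (f z) powr p) / pi"
  have F0: "F \<ge> 0" unfolding F_def set_lebesgue_integral_def by (intro divide_nonneg_nonneg Bochner_Integration.integral_nonneg) auto
  have "((\<lambda>R. (R - norm z)\<^sup>2 * norm (f z) powr p) \<longlongrightarrow> (1 - norm z)\<^sup>2 * norm (f z) powr p) (at_left 1)"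
    by (intro tendsto_intros)
  moreover have "eventually (\<lambda>R. (R - norm z)\<^sup>2 * norm (f z) powr p \<le> K * F) (at_left 1)"
    using eventually_at_left_real[OF z]
  proof eventually_elim
    case (elim R)
    then show ?case
      using bergman_growth_subdisk[OF p, of f R z] f by (simp add: bergman_def K_def F_def)
  qed
  ultimately have "(1 - norm z)\<^sup>2 * norm (f z) powr p \<le> K * F"
    by (rule tendsto_upperbound) simp
  then have "((1 - norm z)\<^sup>2 * norm (f z) powr p) powr (1 / p) \<le> (K * F) powr (1 / p)"
    using p by (intro powr_mono2) auto
  moreover have "((1 - norm z)\<^sup>2 * norm (f z) powr p) powr (1 / p) = (1 - norm z) powr (2 / p) * norm (f z)"
    using p z by (simp add: powr_mult powr_powr flip: powr_numeral)
  moreover have "(K * F) powr (1 / p) = K powr (1 / p) * bergman_norm p f"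
    using K F0 by (simp add: powr_mult bergman_norm_def flip: F_def)
  ultimately have "(1 - norm z) powr (2 / p) * norm (f z) \<le> K powr (1 / p) * bergman_norm p f" by simp
  then show "norm (f z) \<le> K powr (1 / p) * bergman_norm p f * (1 - norm z) powr (-(2 / p))"
    using z by (simp add: powr_minus field_simps)
qed

section \<open>Moments of Carleson measures\<close>

lemma space_unit_interval:
  assumes "sets \<mu> = sets (restrict_space borel {0..<1::real})"
  shows "space \<mu> = {0..<1}"
  using sets_eq_imp_space_eq[OF assms] by (simp add: space_restrict_space)

lemma measurable_ident_unit_interval:
  assumes "sets \<mu> = sets (restrict_space borel {0..<1::real})"
  shows "(\<lambda>t. t) \<in> borel_measurable \<mu>"
  unfolding measurable_cong_sets[OF assms refl] by (intro measurable_restrict_space1) simp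

lemma measurable_disk_diameter:
  fixes f :: "complex \<Rightarrow> complex"
  assumes sets: "sets \<mu> = sets (restrict_space borel {0..<1::real})" and f: "f holomorphic_on ball 0 1"
  shows "(\<lambda>t. f (of_real t)) \<in> borel_measurable \<mu>"
  unfolding measurable_cong_sets[OF sets refl]
  by (intro borel_measurable_continuous_on_restrict continuous_on_compose2[OF holomorphic_on_imp_continuous_on[OF f]])
     (auto intro!: continuous_intros)

lemma carleson_finite_measure:
  assumes "sets \<mu> = sets (restrict_space borel {0..<1::real})" "carleson s \<mu>"
  shows "finite_measure \<mu>"
proof -
  obtain M where "\<And>t. t \<in> {0..<1} \<Longrightarrow> emeasure \<mu> {t..<1} \<le> ennreal (M * (1 - t) powr s)"
    using assms(2) unfolding carleson_def by blast
  from this[of 0] show ?thesis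
    by (intro finite_measureI) (auto simp: space_unit_interval[OF assms(1)] top_unique)
qed

lemma nn_integral_Beta:
  assumes "a > 0" "b > (0::real)"
  shows "(\<integral>\<^sup>+x. ennreal (x powr (a - 1) * (1 - x) powr (b - 1)) * indicator {0<..<1} x \<partial>lborel) = ennreal (Beta a b)"
proof -
  have "((\<lambda>x. x powr (a - 1) * (1 - x) powr (b - 1)) has_integral Beta a b) {0<..<1}"
    using has_integral_Beta_real[OF assms] by (simp add: has_integral_Icc_iff_Ioo)
  then show ?thesis
    by (intro nn_integral_has_integral_lebesgue') auto
qed

text \<open>Since \<open>t ^ n * (1 - t) powr -a\<close> increases in \<open>t\<close>, it is the integral of
  its nonnegative derivative. Tonelli replaces \<open>d\<mu>(t)\<close> by
  \<open>\<mu> [x,1) dx\<close>, the Carleson condition bounds this by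
  \<open>M * (1 - x) powr s dx\<close>, and what remains are two Beta integrals with the same
  quotient of Gamma values. The exact form \<open>fact n / Gamma (n + 1 + s - a)\<close> is kept
  because it cancels against the binomial coefficients.\<close>

lemma carleson_moment_bound:
  assumes sets: "sets \<mu> = sets (restrict_space borel {0..<1::real})"
    and carl: "carleson s \<mu>" and a: "0 \<le> a" "a < s"
  obtains C where "C > 0"
    "\<And>n. (\<integral>\<^sup>+t. ennreal (t ^ n * (1 - t) powr (-a)) \<partial>\<mu>) \<le> ennreal (C * (fact n / Gamma (real n + 1 + (s - a))))"
proof -
  define \<delta> where "\<delta> = s - a"
  have \<delta>: "\<delta> > 0" using a by (simp add: \<delta>_def)
  note space = space_unit_interval[OF sets]
  obtain M where M: "M > 0" and Mle: "\<And>t. t \<in> {0..<1} \<Longrightarrow> emeasure \<mu> {t..<1} \<le> ennreal (M * (1 - t) powr s)"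
    using carl by (auto simp: carleson_def)
  have M0: "emeasure \<mu> (space \<mu>) \<le> ennreal M" using Mle[of 0] by (simp add: space)
  interpret finite_measure \<mu>
    by (rule finite_measureI) (use M0 in \<open>auto simp: top_unique\<close>)
  interpret pair_sigma_finite \<mu> lborel ..
  note [measurable] = measurable_ident_unit_interval[OF sets]
  define C where "C = M * (Gamma (\<delta> + 1) + a * Gamma \<delta>)"
  have "Gamma (\<delta> + 1) > 0" "a * Gamma \<delta> \<ge> 0"
    using \<delta> a by (auto intro!: Gamma_real_pos mult_nonneg_nonneg less_imp_le[OF Gamma_real_pos])
  then have C: "C > 0" using M unfolding C_def by (intro mult_pos_pos add_pos_nonneg)
  moreover have "(\<integral>\<^sup>+t. ennreal (t ^ n * (1 - t) powr (-a)) \<partial>\<mu>) \<le> ennreal (C * (fact n / Gamma (real n + 1 + (s - a))))" for n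
  proof -
    define v1 v2 where "v1 = (\<lambda>x::real. real n * x ^ (n - 1) * (1 - x) powr (-a))"
      and "v2 = (\<lambda>x::real. a * x ^ n * (1 - x) powr (-a - 1))"
    have [measurable]: "v1 \<in> borel_measurable borel" "v2 \<in> borel_measurable borel"
      unfolding v1_def v2_def by measurable
    have nonneg: "v1 x \<ge> 0" "v2 x \<ge> 0" if "0 \<le> x" for x
      using a that by (auto simp: v1_def v2_def)
    have ftc: "ennreal (t ^ n * (1 - t) powr (-a)) = ennreal (0 ^ n) +
        (\<integral>\<^sup>+x. ennreal (v1 x + v2 x) * (if 0 \<le> x \<and> x \<le> t then 1 else 0) \<partial>lborel)" if t: "t \<in> space \<mu>" for t
    proof -
      have t: "0 \<le> t" "t < 1" using t space by auto
      define u where "u = (\<lambda>x::real. x ^ n * (1 - x) powr (-a))"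
      have der: "(u has_real_derivative (v1 x + v2 x)) (at x)" if "0 \<le> x" "x \<le> t" for x
        unfolding u_def v1_def v2_def
        by (rule derivative_eq_intros refl | use that t in simp)+
      have "(\<integral>\<^sup>+x. ennreal (v1 x + v2 x) * indicator {0..t} x \<partial>lborel) = ennreal (u t - u 0)"
        using t nonneg by (intro nn_integral_FTC_Icc der) (auto intro: add_nonneg_nonneg)
      moreover have "u 0 \<le> u t"
        using t by (intro DERIV_nonneg_imp_nondecreasing[OF t(1)]) (use der nonneg in \<open>fastforce intro: add_nonneg_nonneg\<close>)
      moreover have "u 0 = 0 ^ n" by (simp add: u_def)
      ultimately have "ennreal (u t) = ennreal (0 ^ n) + (\<integral>\<^sup>+x. ennreal (v1 x + v2 x) * indicator {0..t} x \<partial>lborel)"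
        by (simp flip: ennreal_plus)
      also have "(\<integral>\<^sup>+x. ennreal (v1 x + v2 x) * indicator {0..t} x \<partial>lborel)
        = (\<integral>\<^sup>+x. ennreal (v1 x + v2 x) * (if 0 \<le> x \<and> x \<le> t then 1 else 0) \<partial>lborel)"
        by (intro nn_integral_cong) (auto split: split_indicator)
      finally show ?thesis by (simp add: u_def)
    qed
    have inner: "(\<integral>\<^sup>+t. ennreal (v1 x + v2 x) * (if 0 \<le> x \<and> x \<le> t then 1 else 0) \<partial>\<mu>)
        \<le> ennreal M * (ennreal (real n * (x ^ (n - 1) * (1 - x) powr \<delta>)) * indicator {0<..<1} x
           + ennreal (a * (x powr (real n + 1 - 1) * (1 - x) powr (\<delta> - 1))) * indicator {0<..<1} x)" if x: "x \<noteq> 0" for x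
    proof (cases "0 < x \<and> x < 1")
      case True
      have "(\<integral>\<^sup>+t. ennreal (v1 x + v2 x) * (if 0 \<le> x \<and> x \<le> t then 1 else 0) \<partial>\<mu>)
          = (\<integral>\<^sup>+t. ennreal (v1 x + v2 x) * indicator {x..<1} t \<partial>\<mu>)"
        using True space by (intro nn_integral_cong) (auto split: split_indicator)
      also have "\<dots> = ennreal (v1 x + v2 x) * emeasure \<mu> {x..<1}"
        using True by (intro nn_integral_cmult_indicator) (auto simp: sets sets_restrict_space_iff)
      also have "\<dots> \<le> ennreal (v1 x + v2 x) * ennreal (M * (1 - x) powr s)"
        using True by (intro mult_left_mono Mle) auto
      also have "\<dots> = ennreal (M * ((v1 x + v2 x) * (1 - x) powr s))"
        using True M nonneg by (subst ennreal_mult[symmetric]) (auto simp: mult_ac intro!: add_nonneg_nonneg)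
      also have "(v1 x + v2 x) * (1 - x) powr s = real n * (x ^ (n - 1) * (1 - x) powr \<delta>)
          + a * (x powr (real n + 1 - 1) * (1 - x) powr (\<delta> - 1))"
      proof -
        have "(1 - x) powr (-a) * (1 - x) powr s = (1 - x) powr \<delta>"
          "(1 - x) powr (-a - 1) * (1 - x) powr s = (1 - x) powr (\<delta> - 1)"
          by (simp_all add: \<delta>_def algebra_simps flip: powr_add)
        then show ?thesis using True
          by (simp add: v1_def v2_def distrib_right mult.assoc powr_realpow)
      qed
      also have "ennreal (M * (real n * (x ^ (n - 1) * (1 - x) powr \<delta>)
          + a * (x powr (real n + 1 - 1) * (1 - x) powr (\<delta> - 1))))
        = ennreal M * (ennreal (real n * (x ^ (n - 1) * (1 - x) powr \<delta>))
          + ennreal (a * (x powr (real n + 1 - 1) * (1 - x) powr (\<delta> - 1))))"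
        using True a M by (subst ennreal_mult) (auto intro!: add_nonneg_nonneg)
      finally show ?thesis using True by simp
    next
      case False
      then have "(\<integral>\<^sup>+t. ennreal (v1 x + v2 x) * (if 0 \<le> x \<and> x \<le> t then 1 else 0) \<partial>\<mu>) = (\<integral>\<^sup>+t. 0 \<partial>\<mu>)"
        using x space by (intro nn_integral_cong) auto
      then show ?thesis by simp
    qed
    \<comment> \<open>The boundary value at \<open>t = 0\<close> is nonzero only for \<open>n = 0\<close>, exactly when the integral next to it vanishes.\<close>
    have first: "ennreal (0 ^ n) + (\<integral>\<^sup>+x. ennreal (real n * (x ^ (n - 1) * (1 - x) powr \<delta>)) * indicator {0<..<1} x \<partial>lborel)
       = ennreal (Gamma (\<delta> + 1) * (fact n / Gamma (real n + 1 + \<delta>)))"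
    proof (cases "n = 0")
      case True
      have "Gamma (1 + \<delta>) > 0" using \<delta> by (intro Gamma_real_pos) simp
      then show ?thesis using True by (simp add: add.commute)
    next
      case False
      have "(\<integral>\<^sup>+x. ennreal (real n * (x ^ (n - 1) * (1 - x) powr \<delta>)) * indicator {0<..<1} x \<partial>lborel)
         = (\<integral>\<^sup>+x. ennreal (real n) * (ennreal (x powr (real n - 1) * (1 - x) powr ((\<delta> + 1) - 1)) * indicator {0<..<1} x) \<partial>lborel)"
        using False by (intro nn_integral_cong) (auto simp: ennreal_mult powr_realpow[symmetric] of_nat_diff split: split_indicator)
      also have "\<dots> = ennreal (real n) * ennreal (Beta (real n) (\<delta> + 1))"
        using False \<delta> nn_integral_Beta[of "real n" "\<delta> + 1"] by (subst nn_integral_cmult) auto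
      also have "\<dots> = ennreal (real n * Beta (real n) (\<delta> + 1))"
        by (rule ennreal_mult'[symmetric]) simp
      also have "real n * Beta (real n) (\<delta> + 1) = Gamma (\<delta> + 1) * (fact n / Gamma (real n + 1 + \<delta>))"
      proof -
        have "real n * Gamma (real n) = Gamma (real n + 1)" using False by (intro Gamma_plus1[symmetric]) (auto elim!: nonpos_Ints_cases)
        also have "\<dots> = fact n" using Gamma_fact[of n, where 'a = real] by (simp add: add.commute)
        finally show ?thesis by (simp add: Beta_def add_ac)
      qed
      finally show ?thesis using False by simp
    qed
    have second: "(\<integral>\<^sup>+x. ennreal (a * (x powr (real n + 1 - 1) * (1 - x) powr (\<delta> - 1))) * indicator {0<..<1} x \<partial>lborel)
       = ennreal (a * Gamma \<delta> * (fact n / Gamma (real n + 1 + \<delta>)))"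
    proof -
      have "(\<integral>\<^sup>+x. ennreal (a * (x powr (real n + 1 - 1) * (1 - x) powr (\<delta> - 1))) * indicator {0<..<1} x \<partial>lborel)
         = (\<integral>\<^sup>+x. ennreal a * (ennreal (x powr (real n + 1 - 1) * (1 - x) powr (\<delta> - 1)) * indicator {0<..<1} x) \<partial>lborel)"
        using a by (intro nn_integral_cong) (auto simp: ennreal_mult split: split_indicator)
      also have "\<dots> = ennreal a * ennreal (Beta (real n + 1) \<delta>)"
        using \<delta> nn_integral_Beta[of "real n + 1" \<delta>] by (subst nn_integral_cmult) auto
      also have "\<dots> = ennreal (a * Beta (real n + 1) \<delta>)"
        using a by (intro ennreal_mult'[symmetric]) simp
      also have "a * Beta (real n + 1) \<delta> = a * Gamma \<delta> * (fact n / Gamma (real n + 1 + \<delta>))"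
        using Gamma_fact[of n, where 'a = real] by (simp add: Beta_def add.commute)
      finally show ?thesis .
    qed
    have "(\<integral>\<^sup>+t. ennreal (t ^ n * (1 - t) powr (-a)) \<partial>\<mu>) = (\<integral>\<^sup>+t. ennreal (0 ^ n) +
        (\<integral>\<^sup>+x. ennreal (v1 x + v2 x) * (if 0 \<le> x \<and> x \<le> t then 1 else 0) \<partial>lborel) \<partial>\<mu>)"
      using ftc by (rule nn_integral_cong)
    also have "\<dots> = ennreal (0 ^ n) * emeasure \<mu> (space \<mu>) +
        (\<integral>\<^sup>+t. \<integral>\<^sup>+x. ennreal (v1 x + v2 x) * (if 0 \<le> x \<and> x \<le> t then 1 else 0) \<partial>lborel \<partial>\<mu>)"
      by (subst nn_integral_add) auto
    also have "(\<integral>\<^sup>+t. \<integral>\<^sup>+x. ennreal (v1 x + v2 x) * (if 0 \<le> x \<and> x \<le> t then 1 else 0) \<partial>lborel \<partial>\<mu>)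
      = (\<integral>\<^sup>+x. \<integral>\<^sup>+t. ennreal (v1 x + v2 x) * (if 0 \<le> x \<and> x \<le> t then 1 else 0) \<partial>\<mu> \<partial>lborel)"
      by (rule Fubini'[symmetric]) measurable
    also have "ennreal (0 ^ n) * emeasure \<mu> (space \<mu>) + \<dots> \<le> ennreal (0 ^ n) * ennreal M +
      (\<integral>\<^sup>+x. ennreal M * (ennreal (real n * (x ^ (n - 1) * (1 - x) powr \<delta>)) * indicator {0<..<1} x
           + ennreal (a * (x powr (real n + 1 - 1) * (1 - x) powr (\<delta> - 1))) * indicator {0<..<1} x) \<partial>lborel)"
    proof (intro add_mono mult_left_mono M0 nn_integral_mono_AE)
      show "AE x in lborel. (\<integral>\<^sup>+t. ennreal (v1 x + v2 x) * (if 0 \<le> x \<and> x \<le> t then 1 else 0) \<partial>\<mu>)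
        \<le> ennreal M * (ennreal (real n * (x ^ (n - 1) * (1 - x) powr \<delta>)) * indicator {0<..<1} x
           + ennreal (a * (x powr (real n + 1 - 1) * (1 - x) powr (\<delta> - 1))) * indicator {0<..<1} x)"
        using AE_lborel_singleton[of "0::real"] by eventually_elim (rule inner)
    qed simp
    also have "\<dots> = ennreal M * ((ennreal (0 ^ n) + (\<integral>\<^sup>+x. ennreal (real n * (x ^ (n - 1) * (1 - x) powr \<delta>)) * indicator {0<..<1} x \<partial>lborel))
       + (\<integral>\<^sup>+x. ennreal (a * (x powr (real n + 1 - 1) * (1 - x) powr (\<delta> - 1))) * indicator {0<..<1} x \<partial>lborel))"
      by (simp add: nn_integral_cmult nn_integral_add distrib_left mult.commute add.assoc del: add_diff_cancel_right')
    also have "\<dots> = ennreal M * ennreal (Gamma (\<delta> + 1) * (fact n / Gamma (real n + 1 + \<delta>)) + a * Gamma \<delta> * (fact n / Gamma (real n + 1 + \<delta>)))"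
      unfolding first second using \<delta> a
      by (subst ennreal_plus) (auto intro!: mult_nonneg_nonneg divide_nonneg_nonneg less_imp_le[OF Gamma_real_pos])
    also have "\<dots> = ennreal (M * (Gamma (\<delta> + 1) * (fact n / Gamma (real n + 1 + \<delta>)) + a * Gamma \<delta> * (fact n / Gamma (real n + 1 + \<delta>))))"
      using M by (intro ennreal_mult'[symmetric]) simp
    also have "\<dots> = ennreal (C * (fact n / Gamma (real n + 1 + (s - a))))"
    proof -
      have "M * (A * X + B * X) = M * (A + B) * X" for A B X :: real
        by (simp add: algebra_simps)
      then show ?thesis unfolding C_def \<delta>_def by (simp only:)
    qed
    finally show ?thesis .
  qed
  ultimately show ?thesis by (rule that)
qed

lemma carleson_integrable_powr:
  assumes sets: "sets \<mu> = sets (restrict_space borel {0..<1::real})"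
    and carl: "carleson s \<mu>" and a: "0 \<le> a" "a < s"
  obtains C where "C > 0" "\<And>n. integrable \<mu> (\<lambda>t. t ^ n * (1 - t) powr (-a))"
    "\<And>n. (LINT t|\<mu>. t ^ n * (1 - t) powr (-a)) \<le> C * (fact n / Gamma (real n + 1 + (s - a)))"
proof -
  obtain C where C: "C > 0"
    "\<And>n. (\<integral>\<^sup>+t. ennreal (t ^ n * (1 - t) powr (-a)) \<partial>\<mu>) \<le> ennreal (C * (fact n / Gamma (real n + 1 + (s - a))))"
    using carleson_moment_bound[OF assms] by blast
  note [measurable] = measurable_ident_unit_interval[OF sets]
  have nonneg: "AE t in \<mu>. 0 \<le> t ^ n * (1 - t) powr (-a)" for n
    using space_unit_interval[OF sets] by (intro AE_I2) auto
  have int: "integrable \<mu> (\<lambda>t. t ^ n * (1 - t) powr (-a))" for n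
    using nonneg order.strict_trans1[OF C(2)[of n] ennreal_less_top] by (intro integrableI_nonneg) auto
  moreover have "(LINT t|\<mu>. t ^ n * (1 - t) powr (-a)) \<le> C * (fact n / Gamma (real n + 1 + (s - a)))" for n
  proof -
    have "ennreal (LINT t|\<mu>. t ^ n * (1 - t) powr (-a)) \<le> ennreal (C * (fact n / Gamma (real n + 1 + (s - a))))"
      using C(2)[of n] nn_integral_eq_integral[OF int nonneg, of n] by simp
    moreover have "0 \<le> C * (fact n / Gamma (real n + 1 + (s - a)))"
      using C(1) a by (intro mult_nonneg_nonneg divide_nonneg_pos Gamma_real_pos) auto
    ultimately show ?thesis by simp
  qed
  ultimately show ?thesis using C(1) that by blast
qed

section \<open>Partial sums of power series and rows of the Hankel matrix\<close>

text \<open>By concavity the sine lies above its chords on \<open>[0, \<pi>/2]\<close>; the other half follows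
  by symmetry.\<close>

lemma sin_pi_ge:
  assumes "0 \<le> x" "x \<le> 1"
  shows "min x (1 - x) \<le> sin (pi * x)"
proof -
  have conv: "convex_on {0..pi} (\<lambda>y. - sin y)"
    by (rule f''_ge0_imp_convex[where f' = "\<lambda>y. - cos y" and f'' = sin])
       (auto intro!: derivative_eq_intros sin_ge_zero)
  have *: "2 * y \<le> sin (pi * y)" if "0 \<le> y" "y \<le> 1/2" for y :: real
  proof -
    have "- sin ((1 - 2 * y) *\<^sub>R 0 + (2 * y) *\<^sub>R (pi / 2)) \<le> (1 - 2 * y) * - sin 0 + (2 * y) * - sin (pi / 2)"
      using that by (intro convex_onD[OF conv]) auto
    then show ?thesis by (simp add: mult_ac)
  qed
  show ?thesis
  proof (cases "x \<le> 1/2")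
    case True
    then show ?thesis using *[of x] assms by simp
  next
    case False
    moreover have "sin (pi * (1 - x)) = sin (pi * x)"
      by (simp add: right_diff_distrib sin_diff)
    ultimately show ?thesis using *[of "1 - x"] assms by simp
  qed
qed

lemma norm_one_minus_circlepath_ge:
  assumes \<rho>: "1 / 2 \<le> \<rho>" "\<rho> < 1" and x: "0 \<le> x" "x \<le> 1"
  shows "(1 - \<rho> + min x (1 - x)) / 2 \<le> norm (1 - circlepath 0 \<rho> x)"
proof -
  have c: "circlepath 0 \<rho> x = of_real \<rho> * cis (2 * (pi * x))"
    by (simp add: circlepath cis_conv_exp mult_ac)
  have "1 - \<rho> \<le> norm (1 - circlepath 0 \<rho> x)"
    using norm_triangle_ineq2[of 1 "circlepath 0 \<rho> x"] \<rho> by (simp add: c norm_mult)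
  moreover have "min x (1 - x) \<le> norm (1 - circlepath 0 \<rho> x)"
  proof (rule power2_le_imp_le)
    have "(min x (1 - x))\<^sup>2 \<le> (sin (pi * x))\<^sup>2"
      using sin_pi_ge[OF x] x by (intro power_mono) auto
    also have "\<dots> \<le> (2 * \<rho>) * (2 * (sin (pi * x))\<^sup>2)"
      using \<rho> mult_right_mono[of 1 "4 * \<rho>" "(sin (pi * x))\<^sup>2"] by simp
    also have "\<dots> = (2 * \<rho>) * (1 - cos (2 * (pi * x)))"
      by (simp add: cos_double_sin)
    also have "\<dots> \<le> (1 - \<rho>)\<^sup>2 + (2 * \<rho>) * (1 - cos (2 * (pi * x)))" by simp
    also have "\<dots> = (1 - \<rho> * cos (2 * (pi * x)))\<^sup>2 + (\<rho> * sin (2 * (pi * x)))\<^sup>2"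
    proof -
      have "(1 - \<rho> * C)\<^sup>2 + (\<rho> * S)\<^sup>2 = (1 - \<rho>)\<^sup>2 + (2 * \<rho>) * (1 - C)" if "S\<^sup>2 + C\<^sup>2 = 1" for S C
      proof -
        have "(1 - \<rho> * C)\<^sup>2 + (\<rho> * S)\<^sup>2 = 1 - 2 * \<rho> * C + \<rho>\<^sup>2 * (S\<^sup>2 + C\<^sup>2)"
          by (simp add: power2_eq_square algebra_simps)
        then show ?thesis unfolding that by (simp add: power2_eq_square algebra_simps)
      qed
      from this[OF sin_cos_squared_add] show ?thesis by simp
    qed
    also have "\<dots> = (norm (1 - circlepath 0 \<rho> x))\<^sup>2"
      by (simp add: cmod_power2 c)
    finally show "(min x (1 - x))\<^sup>2 \<le> (norm (1 - circlepath 0 \<rho> x))\<^sup>2" .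
  qed simp
  ultimately have "(1 - \<rho> + min x (1 - x)) / 2 \<le> (norm (1 - circlepath 0 \<rho> x) + norm (1 - circlepath 0 \<rho> x)) / 2"
    by (intro divide_right_mono add_mono) auto
  then show ?thesis by simp
qed

lemma inverse_norm_one_minus_circlepath_le:
  assumes \<rho>: "1 / 2 \<le> \<rho>" "\<rho> < 1" and x: "0 \<le> x" "x \<le> 1"
  shows "1 / norm (1 - circlepath 0 \<rho> x) \<le> 2 / (1 - \<rho> + x) + 2 / (1 - \<rho> + (1 - x))"
proof -
  have pos: "(1 - \<rho> + min x (1 - x)) / 2 > 0" using \<rho> x by (simp add: min_def)
  have "1 / norm (1 - circlepath 0 \<rho> x) \<le> 1 / ((1 - \<rho> + min x (1 - x)) / 2)"
    using norm_one_minus_circlepath_ge[OF assms] pos by (intro divide_left_mono mult_pos_pos) auto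
  also have "\<dots> = 2 / (1 - \<rho> + min x (1 - x))" by simp
  also have "\<dots> \<le> 2 / (1 - \<rho> + x) + 2 / (1 - \<rho> + (1 - x))"
    using \<rho> x by (auto simp: min_def)
  finally show ?thesis .
qed

text \<open>The logarithmic size of this integral is the reason why partial sums grow only slightly faster
  than the function itself.\<close>

lemma log_kernel_has_integral:
  fixes \<delta> :: real
  assumes "\<delta> > 0"
  shows "((\<lambda>x. 2 / (\<delta> + x) + 2 / (\<delta> + (1 - x))) has_integral (4 * ln (1 + 1 / \<delta>))) {0..1}"
proof -
  have "((\<lambda>x. 2 / (\<delta> + x) + 2 / (\<delta> + (1 - x))) has_integral
     ((2 * ln (\<delta> + 1) - 2 * ln (\<delta> + (1 - 1))) - (2 * ln (\<delta> + 0) - 2 * ln (\<delta> + (1 - 0))))) {0..1}"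
    using assms by (intro fundamental_theorem_of_calculus)
      (auto intro!: derivative_eq_intros simp flip: has_real_derivative_iff_has_vector_derivative)
  moreover have "ln (1 + 1 / \<delta>) = ln (\<delta> + 1) - ln \<delta>"
  proof -
    have "1 + 1 / \<delta> = (\<delta> + 1) / \<delta>" using assms by (simp add: field_simps)
    then show ?thesis using assms by (simp add: ln_div)
  qed
  ultimately show ?thesis using assms by simp
qed

lemma sum_inverse_powers:
  fixes u :: complex
  assumes "u \<noteq> 0" "u \<noteq> 1"
  shows "(\<Sum>k\<le>N. 1 / u ^ Suc k) = (1 / u ^ Suc N - 1) / (1 - u)"
proof (induction N)
  case (Suc N)
  have "(1 / P - 1) / (1 - u) + 1 / (u * P) = (1 / (u * P) - 1) / (1 - u)" if "P \<noteq> 0" for P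
    using assms that by (simp add: divide_simps) (simp add: algebra_simps)
  from this[of "u ^ Suc N"] show ?case using assms by (simp add: Suc.IH del: power_Suc add: power_Suc[of u "Suc N"])
qed (use assms in \<open>simp add: field_simps\<close>)

text \<open>Summing Cauchy's formulas for the coefficients gives the integral of
  \<open>f u * (u powr -(N + 1) - 1) / (1 - u)\<close> over the circle of radius
  \<open>1 - 1/(N + 2)\<close>. On this circle \<open>f\<close> is of order \<open>N powr a\<close>,
  the numerator stays bounded, and \<open>1 / norm (1 - u)\<close> has mean of order
  \<open>ln N\<close>, which any power \<open>N powr (b - a)\<close> absorbs. A coefficientwise
  estimate would lose a full power of \<open>N\<close> instead.\<close>

lemma taylor_partial_sum_bound:
  assumes f: "f holomorphic_on ball 0 1" and K: "K \<ge> 0" and a: "a \<ge> 0"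
    and growth: "\<And>z. norm z < 1 \<Longrightarrow> norm (f z) \<le> K * (1 - norm z) powr (-a)"
    and ab: "a < b"
  obtains C where "C \<ge> 0" "\<And>N. norm (\<Sum>k\<le>N. taylor_coeff f k) \<le> C * (real N + 1) powr b"
proof
  define \<epsilon> where "\<epsilon> = b - a"
  have \<epsilon>: "\<epsilon> > 0" using ab by (simp add: \<epsilon>_def)
  define C where "C = K * 2 powr a * 4 * (4 * (3 powr \<epsilon> / \<epsilon>))"
  show "C \<ge> 0" using K \<epsilon> by (simp add: C_def)
  fix N :: nat
  \<comment> \<open>The shift by \<open>2\<close> keeps the radius at least \<open>1/2\<close>, also for \<open>N = 0\<close>.\<close>
  define \<rho> where "\<rho> = 1 - 1 / (real N + 2)"
  have \<rho>: "1 / 2 \<le> \<rho>" "\<rho> < 1" by (auto simp: \<rho>_def field_simps)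
  have \<delta>: "1 - \<rho> = 1 / (real N + 2)" by (simp add: \<rho>_def)
  have path: "norm (circlepath 0 \<rho> x) = \<rho>" for x
    using \<rho> by (simp add: circlepath norm_mult)
  have int1: "((\<lambda>u. f u / u ^ Suc k) has_contour_integral (2 * pi * \<i> * taylor_coeff f k)) (circlepath 0 \<rho>)" for k
  proof -
    have "((\<lambda>u. f u / (u - 0) ^ Suc k) has_contour_integral ((2 * pi * \<i>) / (fact k) * (deriv ^^ k) f 0)) (circlepath 0 \<rho>)"
      using f \<rho> by (intro Cauchy_has_contour_integral_higher_derivative_circlepath)
        (auto intro!: holomorphic_on_imp_continuous_on intro: holomorphic_on_subset)
    then show ?thesis by (simp add: taylor_coeff_def)
  qed
  define F where "F = (\<lambda>u. \<Sum>k\<le>N. f u / u ^ Suc k)"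
  have "(F has_contour_integral (\<Sum>k\<le>N. 2 * pi * \<i> * taylor_coeff f k)) (circlepath 0 \<rho>)"
    unfolding F_def by (intro has_contour_integral_sum int1) auto
  then have int: "((\<lambda>x. F (circlepath 0 \<rho> x) * vector_derivative (circlepath 0 \<rho>) (at x)) has_integral
      (2 * pi * \<i> * (\<Sum>k\<le>N. taylor_coeff f k))) {0..1}"
    by (simp add: has_contour_integral sum_distrib_left)
  have F_eq: "F u = f u * (1 / u ^ Suc N - 1) / (1 - u)" if "u \<noteq> 0" "u \<noteq> 1" for u
    using sum_inverse_powers[OF that, of N] by (simp add: F_def divide_inverse flip: sum_distrib_left)
  have pow: "1 / \<rho> ^ Suc N \<le> 3"
  proof -
    have "1 / \<rho> = 1 + 1 / real (Suc N)" by (simp add: \<rho>_def field_simps)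
    then have "1 / \<rho> ^ Suc N = (1 + 1 / real (Suc N)) ^ Suc N"
      by (simp only: power_one_over[symmetric])
    also have "\<dots> \<le> exp 1"
      by (rule exp_ge_one_plus_x_over_n_power_n) auto
    also have "\<dots> \<le> 3" by (rule exp_le)
    finally show ?thesis .
  qed
  define B where "B = K * (real N + 2) powr a * 4"
  have B: "B \<ge> 0" using K by (simp add: B_def)
  have bound: "norm (F (circlepath 0 \<rho> x) * vector_derivative (circlepath 0 \<rho>) (at x)) \<le>
      2 * pi * B * (2 / (1 - \<rho> + x) + 2 / (1 - \<rho> + (1 - x)))" if x: "x \<in> {0..1}" for x
  proof -
    define u where "u = circlepath 0 \<rho> x"
    have nu: "norm u = \<rho>" by (simp add: u_def path)
    then have u: "u \<noteq> 0" "u \<noteq> 1" using \<rho> by auto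
    have vd: "norm (vector_derivative (circlepath 0 \<rho>) (at x)) = 2 * pi * \<rho>"
      using \<rho> by (simp add: vector_derivative_circlepath norm_mult)
    have "norm (F u) = norm (f u) * norm (1 / u ^ Suc N - 1) * (1 / norm (1 - u))"
      using F_eq[OF u] by (simp add: norm_mult norm_divide)
    also have "\<dots> \<le> (K * (real N + 2) powr a) * 4 * (2 / (1 - \<rho> + x) + 2 / (1 - \<rho> + (1 - x)))"
    proof (intro mult_mono)
      have "(1 - \<rho>) powr (-a) = (real N + 2) powr a"
        unfolding \<delta> by (simp add: powr_divide powr_minus)
      then show "norm (f u) \<le> K * (real N + 2) powr a"
        using growth[of u] nu \<rho> by simp
      have "norm (1 / u ^ Suc N - 1) \<le> norm (1 / u ^ Suc N) + norm (1::complex)"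
        by (rule norm_triangle_ineq4)
      also have "\<dots> = 1 / \<rho> ^ Suc N + 1" by (simp only: norm_divide norm_power nu norm_one)
      finally show "norm (1 / u ^ Suc N - 1) \<le> 4" using pow by simp
      show "1 / norm (1 - u) \<le> 2 / (1 - \<rho> + x) + 2 / (1 - \<rho> + (1 - x))"
        unfolding u_def using \<rho> x by (intro inverse_norm_one_minus_circlepath_le) auto
    qed (use K in auto)
    also have "\<dots> = B * (2 / (1 - \<rho> + x) + 2 / (1 - \<rho> + (1 - x)))" by (simp only: B_def)
    finally have "norm (F u) * (2 * pi * \<rho>) \<le> B * (2 / (1 - \<rho> + x) + 2 / (1 - \<rho> + (1 - x))) * (2 * pi * 1)"
      using \<rho> B x by (intro mult_mono mult_nonneg_nonneg add_nonneg_nonneg) auto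
    then show ?thesis by (simp add: norm_mult vd u_def mult_ac)
  qed
  have "norm (2 * pi * \<i> * (\<Sum>k\<le>N. taylor_coeff f k)) \<le> 2 * pi * B * (4 * ln (1 + 1 / (1 - \<rho>)))"
    using integral_norm_bound_integral[OF has_integral_integrable[OF int] _ bound]
      log_kernel_has_integral[of "1 - \<rho>"] \<rho>
      has_integral_mult_right[OF log_kernel_has_integral[of "1 - \<rho>"], of "2 * pi * B"]
      integral_unique[OF int]
    by (auto simp: has_integral_iff)
  then have "norm (\<Sum>k\<le>N. taylor_coeff f k) \<le> B * (4 * ln (1 + 1 / (1 - \<rho>)))"
    by (simp add: norm_mult)
  also have "\<dots> \<le> (K * (2 powr a * (real N + 1) powr a) * 4) * (4 * (3 powr \<epsilon> / \<epsilon> * (real N + 1) powr \<epsilon>))"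
  proof (intro mult_mono)
    have "(real N + 2) powr a \<le> (2 * (real N + 1)) powr a" using a by (intro powr_mono2) auto
    also have "\<dots> = 2 powr a * (real N + 1) powr a" by (subst powr_mult) auto
    finally show "B \<le> K * (2 powr a * (real N + 1) powr a) * 4"
      using K unfolding B_def by (intro mult_right_mono mult_left_mono) auto
    have "ln (1 + 1 / (1 - \<rho>)) = ln (real N + 3)" by (simp add: \<delta> add_ac)
    also have "\<dots> \<le> (real N + 3) powr \<epsilon> / \<epsilon>" using \<epsilon> by (intro ln_powr_bound) auto
    also have "\<dots> \<le> (3 * (real N + 1)) powr \<epsilon> / \<epsilon>"
      using \<epsilon> by (intro divide_right_mono powr_mono2) auto
    finally show "ln (1 + 1 / (1 - \<rho>)) \<le> 3 powr \<epsilon> / \<epsilon> * (real N + 1) powr \<epsilon>"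
      using powr_mult[of 3 "real N + 1" \<epsilon>] by simp
    show "0 \<le> ln (1 + 1 / (1 - \<rho>))" by (simp add: \<delta>)
    then show "0 \<le> 4 * ln (1 + 1 / (1 - \<rho>))" by simp
  qed (use K in auto)
  also have "\<dots> = C * ((real N + 1) powr a * (real N + 1) powr \<epsilon>)"
    by (simp add: C_def mult_ac)
  also have "(real N + 1) powr a * (real N + 1) powr \<epsilon> = (real N + 1) powr b"
    by (simp add: \<epsilon>_def flip: powr_add)
  finally show "norm (\<Sum>k\<le>N. taylor_coeff f k) \<le> C * (real N + 1) powr b" .
qed

text \<open>With \<open>y = (k + 1) * (1 - x)\<close> this is the boundedness of
  \<open>y powr b * exp (- y)\<close>.\<close>

lemma powr_times_power_le:
  fixes x b :: real
  assumes x: "0 \<le> x" "x < 1" and b: "b > 0"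
  shows "(real k + 1) powr b * x ^ k \<le> exp 1 * b powr b * (1 - x) powr (-b)"
proof -
  define y where "y = (real k + 1) * (1 - x)"
  have y: "y > 0" using x by (simp add: y_def)
  have "y / b \<le> exp (y / b)" using exp_ge_add_one_self[of "y / b"] by linarith
  then have "(y / b) powr b \<le> exp (y / b) powr b" using y b by (intro powr_mono2) auto
  then have "y powr b \<le> b powr b * exp y"
    using y b by (simp add: powr_divide field_simps powr_def[of "exp _"])
  then have "y powr b * exp (- y) \<le> b powr b"
    by (simp add: exp_minus field_simps)
  moreover have "x ^ k \<le> exp 1 * exp (- y)"
  proof -
    have "x \<le> exp (- (1 - x))" using exp_ge_add_one_self[of "- (1 - x)"] by simp
    then have "x ^ k \<le> exp (- (1 - x)) ^ k" using x by (intro power_mono) auto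
    also have "\<dots> = exp (1 - x) * exp (- y)"
      by (simp add: y_def algebra_simps flip: exp_add exp_of_nat_mult)
    also have "\<dots> \<le> exp 1 * exp (- y)" using x by simp
    finally show ?thesis .
  qed
  ultimately have "y powr b * x ^ k \<le> exp 1 * b powr b"
    using order_trans[OF mult_left_mono[of "x ^ k" "exp 1 * exp (- y)" "y powr b"], of "exp 1 * b powr b"]
      mult_left_mono[of "y powr b * exp (- y)" "b powr b" "exp 1"] by (simp add: mult.left_commute)
  moreover have "y powr b = (real k + 1) powr b * (1 - x) powr b"
    using x by (simp add: y_def powr_mult)
  ultimately show ?thesis using x by (simp add: powr_minus field_simps)
qed

lemma summation_by_parts:
  fixes a :: "nat \<Rightarrow> complex"
  shows "(\<Sum>k\<le>N. a k * t ^ k) = (1 - t) * (\<Sum>k<N. (\<Sum>j\<le>k. a j) * t ^ k) + (\<Sum>j\<le>N. a j) * t ^ N"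
proof (induction N)
  case (Suc N)
  then show ?case by (simp add: algebra_simps)
qed simp

text \<open>Summation by parts expresses the partial sums at \<open>t\<close> through those at
  \<open>1\<close>. Half of the decay of \<open>t ^ k\<close>, namely \<open>x ^ k\<close> with
  \<open>x = sqrt t\<close>, is spent on the growth of these sums, and the other half makes the
  remaining series geometric.\<close>

lemma power_series_partial_sum_bound:
  fixes a :: "nat \<Rightarrow> complex"
  assumes C: "C \<ge> 0" and b: "b > 0"
    and A: "\<And>N. norm (\<Sum>k\<le>N. a k) \<le> C * (real N + 1) powr b"
    and t: "0 \<le> t" "t < 1"
  shows "norm (\<Sum>k\<le>N. a k * of_real t ^ k) \<le> C * (3 * exp 1 * b powr b * 2 powr b) * (1 - t) powr (-b)"
proof -
  define x where "x = sqrt t"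
  have x: "0 \<le> x" "x < 1" "t = x ^ 2" using t by (auto simp: x_def real_sqrt_lt_1_iff)
  define D where "D = C * (exp 1 * b powr b * (1 - x) powr (-b))"
  have D: "D \<ge> 0" using C by (simp add: D_def)
  have A': "norm (\<Sum>j\<le>k. a j) * x ^ k \<le> D" for k
  proof -
    have "norm (\<Sum>j\<le>k. a j) * x ^ k \<le> C * (real k + 1) powr b * x ^ k"
      using x by (intro mult_right_mono A) auto
    also have "\<dots> \<le> D" unfolding D_def mult.assoc
      using C powr_times_power_le[OF x(1,2) b, of k] by (intro mult_left_mono) (auto simp: mult.assoc)
    finally show ?thesis .
  qed
  have A'': "norm (\<Sum>j\<le>k. a j) * t ^ k \<le> D * x ^ k" for k
  proof -
    have "t ^ k = x ^ k * x ^ k" unfolding x(3) power2_eq_square by (rule power_mult_distrib)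
    then show ?thesis using mult_right_mono[OF A'[of k], of "x ^ k"] x(1) by (simp add: mult.assoc)
  qed
  have "norm (\<Sum>k\<le>N. a k * of_real t ^ k) \<le>
     norm ((1 - complex_of_real t) * (\<Sum>k<N. (\<Sum>j\<le>k. a j) * of_real t ^ k)) + norm ((\<Sum>j\<le>N. a j) * of_real t ^ N)"
    unfolding summation_by_parts by (rule norm_triangle_ineq)
  also have "\<dots> \<le> 2 * D + D"
  proof (rule add_mono)
    have "norm (\<Sum>k<N. (\<Sum>j\<le>k. a j) * complex_of_real t ^ k) \<le> (\<Sum>k<N. D * x ^ k)"
      using A'' t by (intro sum_norm_le) (auto simp: norm_mult norm_power)
    also have "\<dots> \<le> D * (1 / (1 - x))"
      using x D unfolding sum_distrib_left[symmetric] 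
      by (intro mult_left_mono) (auto simp: sum_gp_strict divide_right_mono)
    finally have "(1 - t) * norm (\<Sum>k<N. (\<Sum>j\<le>k. a j) * complex_of_real t ^ k) \<le> (1 - t) * (D * (1 / (1 - x)))"
      using t by (intro mult_left_mono) auto
    also have "(1 - t) * (D * (1 / (1 - x))) = (1 + x) * D"
    proof -
      have "1 - t = (1 + x) * (1 - x)" unfolding x(3) by (simp add: power2_eq_square algebra_simps)
      then show ?thesis using x(2) by simp
    qed
    also have "\<dots> \<le> 2 * D" using x D by (intro mult_right_mono) auto
    finally show "norm ((1 - complex_of_real t) * (\<Sum>k<N. (\<Sum>j\<le>k. a j) * of_real t ^ k)) \<le> 2 * D"
      using t norm_of_real[of "1 - t", where 'a = complex] by (simp add: norm_mult)
    have "D * x ^ N \<le> D" using x D by (simp add: mult_left_le power_le_one)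
    then show "norm ((\<Sum>j\<le>N. a j) * of_real t ^ N) \<le> D"
      using A''[of N] t by (simp add: norm_mult norm_power)
  qed
  also have "2 * D + D = C * (3 * exp 1 * b powr b) * (1 - x) powr (-b)" by (simp add: D_def)
  also have "\<dots> \<le> C * (3 * exp 1 * b powr b) * (2 powr b * (1 - t) powr (-b))"
  proof (intro mult_left_mono)
    have "1 - t = (1 - x) * (1 + x)" unfolding x(3) by (simp add: power2_eq_square algebra_simps)
    also have "\<dots> \<le> (1 - x) * 2" using x by (intro mult_left_mono) auto
    finally have "(1 - x) powr (-b) \<le> ((1 - t) / 2) powr (-b)"
      using t b by (intro powr_mono2') auto
    then show "(1 - x) powr (-b) \<le> 2 powr b * (1 - t) powr (-b)"
      using t by (simp add: powr_divide powr_minus field_simps)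
  qed (use C in auto)
  finally show ?thesis by (simp add: mult_ac)
qed

text \<open>The partial sums of the row are the \<open>\<mu>\<close>-integrals of \<open>t ^ n\<close> times
  the Taylor polynomials of \<open>f\<close>. These polynomials are dominated by a multiple of
  \<open>(1 - t) powr -b\<close>, which is integrable as soon as \<open>b < s\<close>. Convergence
  of the row may well be only conditional.\<close>

lemma hankel_term_sums:
  assumes sets: "sets \<mu> = sets (restrict_space borel {0..<1::real})"
    and carl: "carleson s \<mu>" and a: "0 \<le> a" "a < s"
    and f: "f holomorphic_on ball 0 1" and K: "K \<ge> 0"
    and growth: "\<And>z. norm z < 1 \<Longrightarrow> norm (f z) \<le> K * (1 - norm z) powr (-a)"
  shows "integrable \<mu> (\<lambda>t. f (of_real t))"
    and "hankel_term \<mu> f n sums (LINT t|\<mu>. of_real (t ^ n) * f (of_real t))"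
proof -
  interpret finite_measure \<mu> by (rule carleson_finite_measure[OF sets carl])
  have space: "space \<mu> = {0..<1}" by (rule space_unit_interval[OF sets])
  note [measurable] = measurable_ident_unit_interval[OF sets]
  note f_meas [measurable] = measurable_disk_diameter[OF sets f]
  have powr_int: "integrable \<mu> (\<lambda>t. (1 - t) powr (-c))" if c: "0 \<le> c" "c < s" for c
  proof -
    obtain C where "\<And>n. integrable \<mu> (\<lambda>t. t ^ n * (1 - t) powr (-c))"
      using carleson_integrable_powr[OF sets carl c] by blast
    from this[of 0] show ?thesis by simp
  qed
  show "integrable \<mu> (\<lambda>t. f (of_real t))"
  proof (rule Bochner_Integration.integrable_bound)
    show "integrable \<mu> (\<lambda>t. K * (1 - t) powr (-a))" using powr_int[OF a] by (intro integrable_mult_right)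
    show "AE t in \<mu>. norm (f (of_real t)) \<le> norm (K * (1 - t) powr (-a))"
    proof (intro AE_I2)
      fix t assume "t \<in> space \<mu>"
      then show "norm (f (of_real t)) \<le> norm (K * (1 - t) powr (-a))"
        using growth[of "of_real t"] space K by simp
    qed
  qed measurable
  \<comment> \<open>An exponent strictly between: above \<open>a\<close> to absorb the logarithm, below \<open>s\<close> for integrability.\<close>
  define b where "b = (a + s) / 2"
  have b: "a < b" "b < s" "b > 0" using a by (auto simp: b_def)
  obtain C where C: "C \<ge> 0" "\<And>N. norm (\<Sum>k\<le>N. taylor_coeff f k) \<le> C * (real N + 1) powr b"
    using taylor_partial_sum_bound[OF f K a(1) growth b(1)] by blast
  define C' where "C' = C * (3 * exp 1 * b powr b * 2 powr b)"
  define S where "S = (\<lambda>N t. complex_of_real (t ^ n) * (\<Sum>k\<le>N. taylor_coeff f k * of_real t ^ k))"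
  have lim: "(\<lambda>N. LINT t|\<mu>. S N t) \<longlonglongrightarrow> (LINT t|\<mu>. of_real (t ^ n) * f (of_real t))"
  proof (rule integral_dominated_convergence)
    show "integrable \<mu> (\<lambda>t. C' * (1 - t) powr (-b))"
      using powr_int[of b] b by (intro integrable_mult_right) auto
    show "AE t in \<mu>. (\<lambda>N. S N t) \<longlonglongrightarrow> of_real (t ^ n) * f (of_real t)"
    proof (intro AE_I2)
      fix t assume "t \<in> space \<mu>"
      then have "complex_of_real t \<in> ball 0 1" using space by auto
      from holomorphic_power_series[OF f this]
      have "(\<lambda>k. taylor_coeff f k * of_real t ^ k) sums f (of_real t)"
        by (simp add: taylor_coeff_def)
      then show "(\<lambda>N. S N t) \<longlonglongrightarrow> of_real (t ^ n) * f (of_real t)"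
        unfolding S_def sums_def_le by (intro tendsto_intros)
    qed
    show "AE t in \<mu>. norm (S N t) \<le> C' * (1 - t) powr (-b)" for N
    proof (intro AE_I2)
      fix t assume "t \<in> space \<mu>"
      then have t: "0 \<le> t" "t < 1" using space by auto
      have "norm (S N t) \<le> 1 * norm (\<Sum>k\<le>N. taylor_coeff f k * of_real t ^ k)"
        unfolding S_def norm_mult using t by (intro mult_right_mono) (auto simp: norm_power power_le_one)
      also have "\<dots> \<le> C' * (1 - t) powr (-b)"
        using power_series_partial_sum_bound[OF C(1) b(3) C(2) t] by (simp add: C'_def)
      finally show "norm (S N t) \<le> C' * (1 - t) powr (-b)" .
    qed
    show "S N \<in> borel_measurable \<mu>" for N unfolding S_def by measurable
  qed measurable
  have pow_int: "integrable \<mu> (\<lambda>t. t ^ m)" for m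
    using space by (intro integrable_const_bound[where B = 1]) (auto simp: power_le_one)
  have "(LINT t|\<mu>. S N t) = (\<Sum>k\<le>N. hankel_term \<mu> f n k)" for N
  proof -
    have "S N = (\<lambda>t. \<Sum>k\<le>N. complex_of_real (t ^ (n + k)) * taylor_coeff f k)"
      by (simp add: S_def fun_eq_iff sum_distrib_left power_add mult_ac)
    then have "(LINT t|\<mu>. S N t) = (\<Sum>k\<le>N. LINT t|\<mu>. complex_of_real (t ^ (n + k)) * taylor_coeff f k)"
      using pow_int by (simp add: Bochner_Integration.integral_sum integrable_mult_left integrable_of_real del: of_real_power)
    also have "\<dots> = (\<Sum>k\<le>N. hankel_term \<mu> f n k)"
      by (simp add: hankel_term_def moment_def integral_complex_of_real del: of_real_power)
    finally show ?thesis .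
  qed
  with lim show "hankel_term \<mu> f n sums (LINT t|\<mu>. of_real (t ^ n) * f (of_real t))"
    by (simp add: sums_def_le)
qed

section \<open>Power series of the two operators\<close>

text \<open>The coefficients of \<open>(1 - w) powr -(\<alpha> + 1)\<close>, in the form in which they occur
  in the definition of the Hankel operator.\<close>

definition binom_coeff :: "real \<Rightarrow> nat \<Rightarrow> real" where
  "binom_coeff \<alpha> n = Gamma (real n + 1 + \<alpha>) / (Gamma (real n + 1) * Gamma (\<alpha> + 1))"

lemma binom_coeff_pos: "\<alpha> > -1 \<Longrightarrow> binom_coeff \<alpha> n > 0"
  unfolding binom_coeff_def by (intro divide_pos_pos mult_pos_pos Gamma_real_pos) auto

lemma binom_coeff_gbinomial:
  assumes "\<alpha> > -1"
  shows "binom_coeff \<alpha> n = (-1) ^ n * ((-(\<alpha> + 1)) gchoose n)"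
proof -
  have "pochhammer (\<alpha> + 1) n = Gamma (\<alpha> + 1 + real n) / Gamma (\<alpha> + 1)"
    using assms by (intro pochhammer_Gamma) (auto elim!: nonpos_Ints_cases)
  moreover have "Gamma (real n + 1) = fact n"
    using Gamma_fact[of n, where 'a = real] by (simp add: add.commute)
  ultimately show ?thesis
    by (simp add: binom_coeff_def gbinomial_pochhammer add_ac)
qed

lemma binom_coeff_sums:
  fixes w :: complex
  assumes "\<alpha> > -1" "norm w < 1"
  shows "(\<lambda>n. of_real (binom_coeff \<alpha> n) * w ^ n) sums (1 / (1 - w) powr of_real (\<alpha> + 1))"
proof -
  have "(\<lambda>n. (complex_of_real (-(\<alpha> + 1)) gchoose n) * (- w) ^ n) sums (1 + - w) powr of_real (-(\<alpha> + 1))"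
    using assms by (intro gen_binomial_complex) auto
  also have "(\<lambda>n. (complex_of_real (-(\<alpha> + 1)) gchoose n) * (- w) ^ n) = (\<lambda>n. of_real (binom_coeff \<alpha> n) * w ^ n)"
  proof
    fix n
    have "complex_of_real (-(\<alpha> + 1)) gchoose n = of_real ((-(\<alpha> + 1)) gchoose n)"
      unfolding gbinomial_pochhammer
      by (simp only: pochhammer_of_real of_real_minus of_real_mult of_real_divide of_real_power of_real_1
          of_real_fact minus_minus)
    then show "(complex_of_real (-(\<alpha> + 1)) gchoose n) * (- w) ^ n = of_real (binom_coeff \<alpha> n) * w ^ n"
      by (simp only: binom_coeff_gbinomial[OF assms(1)] power_minus[of w] of_real_mult of_real_power
           of_real_minus of_real_1 mult_ac)
  qed
  also have "(1 + - w) powr complex_of_real (-(\<alpha> + 1)) = 1 / (1 - w) powr of_real (\<alpha> + 1)"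
    unfolding of_real_minus powr_minus by (simp add: inverse_eq_divide)
  finally show ?thesis .
qed

lemma binom_coeff_sums_real:
  fixes x :: real
  assumes "\<alpha> > -1" "0 \<le> x" "x < 1"
  shows "(\<lambda>n. binom_coeff \<alpha> n * x ^ n) sums ((1 - x) powr -(\<alpha> + 1))"
proof -
  have "complex_of_real ((1 - x) powr (\<alpha> + 1)) = (1 - of_real x) powr of_real (\<alpha> + 1)"
    using assms powr_of_real[of "1 - x" "\<alpha> + 1"] by simp
  then have "complex_of_real ((1 - x) powr -(\<alpha> + 1)) = 1 / (1 - of_real x) powr of_real (\<alpha> + 1)"
    unfolding powr_minus by (simp only: of_real_inverse inverse_eq_divide of_real_divide of_real_1)
  then have "(\<lambda>n. of_real (binom_coeff \<alpha> n * x ^ n)) sums complex_of_real ((1 - x) powr -(\<alpha> + 1))"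
    using binom_coeff_sums[of \<alpha> "of_real x"] assms by simp
  then show ?thesis by (subst (asm) sums_of_real_iff)
qed

text \<open>Expanding the kernel and integrating term by term is justified by \<open>norm z < 1\<close> alone,
  since the expanded series is dominated by an integrable function times a convergent series in
  \<open>norm z\<close>.\<close>

lemma integral_kernel_sums:
  fixes \<phi> :: "real \<Rightarrow> complex"
  assumes \<alpha>: "\<alpha> > -1" and sets: "sets \<mu> = sets (restrict_space borel {0..<1::real})"
    and \<phi>: "integrable \<mu> \<phi>" and z: "norm z < 1"
  shows "integrable \<mu> (\<lambda>t. \<phi> t / (1 - of_real t * z) powr of_real (\<alpha> + 1))"
    and "(\<lambda>n. of_real (binom_coeff \<alpha> n) * (LINT t|\<mu>. of_real (t ^ n) * \<phi> t) * z ^ n) sums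
      (LINT t|\<mu>. \<phi> t / (1 - of_real t * z) powr of_real (\<alpha> + 1))"
proof -
  note space = space_unit_interval[OF sets]
  note [measurable] = measurable_ident_unit_interval[OF sets]
  have [measurable]: "\<phi> \<in> borel_measurable \<mu>" using \<phi> by auto
  define g where "g = (\<lambda>n t. of_real (binom_coeff \<alpha> n) * (of_real t * z) ^ n * \<phi> t)"
  have t: "0 \<le> t \<and> t < 1" if "t \<in> space \<mu>" for t using that space by auto
  have tz: "norm (of_real t * z) < 1" if "t \<in> space \<mu>" for t
    using t[OF that] z mult_strict_mono'[of "norm t" 1 "norm z" 1] by (simp add: norm_mult)
  have gsum: "(\<lambda>n. g n t) sums (\<phi> t / (1 - of_real t * z) powr of_real (\<alpha> + 1))" if "t \<in> space \<mu>" for t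
    using sums_mult2[OF binom_coeff_sums[OF \<alpha> tz[OF that]], of "\<phi> t"] by (simp add: g_def)
  have le: "norm (g n t) \<le> binom_coeff \<alpha> n * norm z ^ n * norm (\<phi> t)" if "t \<in> space \<mu>" for n t
  proof -
    have "t ^ n \<le> 1" using t[OF that] by (intro power_le_one) auto
    then have "binom_coeff \<alpha> n * norm z ^ n * norm (\<phi> t) * t ^ n \<le> binom_coeff \<alpha> n * norm z ^ n * norm (\<phi> t) * 1"
      using binom_coeff_pos[OF \<alpha>, of n] by (intro mult_left_mono) auto
    then show ?thesis using t[OF that] binom_coeff_pos[OF \<alpha>, of n]
      by (simp add: g_def norm_mult norm_power power_mult_distrib mult_ac)
  qed
  have gint: "integrable \<mu> (g n)" for n
  proof (rule Bochner_Integration.integrable_bound)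
    show "integrable \<mu> (\<lambda>t. binom_coeff \<alpha> n * norm z ^ n * norm (\<phi> t))"
      using \<phi> by (intro integrable_mult_right integrable_norm)
    show "AE t in \<mu>. norm (g n t) \<le> norm (binom_coeff \<alpha> n * norm z ^ n * norm (\<phi> t))"
      using order_trans[OF le abs_ge_self] by (intro AE_I2) (simp only: real_norm_def)
    show "g n \<in> borel_measurable \<mu>" unfolding g_def by measurable
  qed
  have sz: "summable (\<lambda>n. binom_coeff \<alpha> n * norm z ^ n)"
    using binom_coeff_sums_real[OF \<alpha> norm_ge_zero z] by (rule sums_summable)
  have 1: "AE t in \<mu>. summable (\<lambda>n. norm (g n t))"
  proof (intro AE_I2)
    fix t assume t: "t \<in> space \<mu>"
    show "summable (\<lambda>n. norm (g n t))"
      by (rule summable_comparison_test'[OF summable_mult2[OF sz, of "norm (\<phi> t)"], of 0])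
         (use le[OF t] in auto)
  qed
  have 2: "summable (\<lambda>n. LINT t|\<mu>. norm (g n t))"
  proof (rule summable_comparison_test'[OF summable_mult2[OF sz, of "LINT t|\<mu>. norm (\<phi> t)"], of 0])
    fix n
    have "(LINT t|\<mu>. norm (g n t)) \<le> (LINT t|\<mu>. binom_coeff \<alpha> n * norm z ^ n * norm (\<phi> t))"
      using \<phi> gint le by (intro integral_mono) (auto intro!: integrable_mult_right)
    moreover have "(LINT t|\<mu>. norm (g n t)) \<ge> 0" by (rule Bochner_Integration.integral_nonneg) auto
    ultimately show "norm (LINT t|\<mu>. norm (g n t)) \<le> binom_coeff \<alpha> n * norm z ^ n * (LINT t|\<mu>. norm (\<phi> t))"
      by simp
  qed
  have eq: "(\<Sum>n. g n t) = \<phi> t / (1 - of_real t * z) powr of_real (\<alpha> + 1)" if "t \<in> space \<mu>" for t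
    using gsum[OF that] by (rule sums_unique[symmetric])
  show "integrable \<mu> (\<lambda>t. \<phi> t / (1 - of_real t * z) powr of_real (\<alpha> + 1))"
    using integrable_suminf[OF gint 1 2] by (subst (asm) Bochner_Integration.integrable_cong[OF refl eq])
  have "(\<lambda>n. LINT t|\<mu>. g n t) sums (LINT t|\<mu>. \<phi> t / (1 - of_real t * z) powr of_real (\<alpha> + 1))"
    using sums_integral[OF gint 1 2] by (subst (asm) Bochner_Integration.integral_cong[OF refl eq])
  moreover have "(LINT t|\<mu>. g n t) = of_real (binom_coeff \<alpha> n) * (LINT t|\<mu>. of_real (t ^ n) * \<phi> t) * z ^ n" for n
  proof -
    have "g n = (\<lambda>t. (of_real (binom_coeff \<alpha> n) * z ^ n) * (of_real (t ^ n) * \<phi> t))"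
      by (simp add: g_def fun_eq_iff power_mult_distrib mult_ac)
    then have "(LINT t|\<mu>. g n t) = (of_real (binom_coeff \<alpha> n) * z ^ n) * (LINT t|\<mu>. of_real (t ^ n) * \<phi> t)"
      by simp
    then show ?thesis by (simp add: mult_ac)
  qed
  ultimately show "(\<lambda>n. of_real (binom_coeff \<alpha> n) * (LINT t|\<mu>. of_real (t ^ n) * \<phi> t) * z ^ n) sums
      (LINT t|\<mu>. \<phi> t / (1 - of_real t * z) powr of_real (\<alpha> + 1))" by simp
qed

lemma integral_op_sums:
  assumes \<alpha>: "\<alpha> > -1" and sets: "sets \<mu> = sets (restrict_space borel {0..<1::real})"
    and int: "integrable \<mu> (\<lambda>t. f (of_real t))" and z: "norm z < 1"
  shows "integrable \<mu> (integral_kernel \<alpha> f z)"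
    and "(\<lambda>n. of_real (binom_coeff \<alpha> n) * (LINT t|\<mu>. of_real (t ^ n) * of_real (norm (f (of_real t)))) * z ^ n)
      sums integral_op \<mu> \<alpha> f z"
proof -
  have "integrable \<mu> (\<lambda>t. complex_of_real (norm (f (of_real t))))"
    using int by (intro integrable_of_real integrable_norm)
  from integral_kernel_sums[OF \<alpha> sets this z]
  show "integrable \<mu> (integral_kernel \<alpha> f z)"
    and "(\<lambda>n. of_real (binom_coeff \<alpha> n) * (LINT t|\<mu>. of_real (t ^ n) * of_real (norm (f (of_real t)))) * z ^ n)
      sums integral_op \<mu> \<alpha> f z"
    by (simp_all add: integral_kernel_def[abs_def] integral_op_def)
qed

lemma hankel_op_sums:
  assumes \<alpha>: "\<alpha> > -1" and sets: "sets \<mu> = sets (restrict_space borel {0..<1::real})"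
    and int: "integrable \<mu> (\<lambda>t. f (of_real t))"
    and rep: "\<And>n. hankel_term \<mu> f n sums (LINT t|\<mu>. of_real (t ^ n) * f (of_real t))"
  shows "hankel_well_defined \<mu> \<alpha> f"
    and "norm z < 1 \<Longrightarrow> (\<lambda>n. of_real (binom_coeff \<alpha> n) * (LINT t|\<mu>. of_real (t ^ n) * f (of_real t)) * z ^ n)
      sums hankel_op \<mu> \<alpha> f z"
proof -
  have coeff: "hankel_coeff \<mu> \<alpha> f n = of_real (binom_coeff \<alpha> n) * (LINT t|\<mu>. of_real (t ^ n) * f (of_real t))" for n
    using sums_unique[OF rep[of n]] by (simp add: hankel_coeff_def binom_coeff_def)
  have sm: "summable (\<lambda>n. hankel_coeff \<mu> \<alpha> f n * z ^ n)" if "norm z < 1" for z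
    unfolding coeff using integral_kernel_sums(2)[OF \<alpha> sets int that]
    by (rule sums_summable)
  then show "hankel_well_defined \<mu> \<alpha> f"
    using sums_summable[OF rep] by (auto simp: hankel_well_defined_def)
  show "(\<lambda>n. of_real (binom_coeff \<alpha> n) * (LINT t|\<mu>. of_real (t ^ n) * f (of_real t)) * z ^ n)
      sums hankel_op \<mu> \<alpha> f z" if "norm z < 1"
    using summable_sums[OF sm[OF that]] by (simp add: hankel_op_def coeff)
qed

section \<open>Bloch functions with small coefficients: sufficiency of the Carleson condition\<close>

lemma deriv_power_series_disk:
  fixes g :: "nat \<Rightarrow> complex"
  assumes G: "\<And>z. norm z < 1 \<Longrightarrow> (\<lambda>n. g n * z ^ n) sums G z" and z: "norm z < 1"
  shows "(\<lambda>n. of_nat (Suc n) * g (Suc n) * z ^ n) sums deriv G z"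
proof -
  have s: "summable (\<lambda>n. g n * z ^ n)" if "norm z < 1" for z using G[OF that] by (rule sums_summable)
  have "((\<lambda>z. \<Sum>n. g n * z ^ n) has_field_derivative (\<Sum>n. diffs g n * z ^ n)) (at z)"
    using termdiffs_strong'[OF s z] .
  then have "(G has_field_derivative (\<Sum>n. diffs g n * z ^ n)) (at z)"
  proof (rule DERIV_cong_ev[THEN iffD1, rotated -1, OF _ refl _ refl])
    have "eventually (\<lambda>w. w \<in> ball 0 1) (nhds z)"
      using z by (intro eventually_nhds_in_open) auto
    then show "eventually (\<lambda>w. (\<Sum>n. g n * w ^ n) = G w) (nhds z)"
      by eventually_elim (use G sums_unique in force)
  qed
  then have "deriv G z = (\<Sum>n. diffs g n * z ^ n)" by (rule DERIV_imp_deriv)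
  moreover have "summable (\<lambda>n. diffs g n * z ^ n)"
    using termdiff_converges[OF z s] by blast
  ultimately show ?thesis by (simp add: diffs_def summable_sums)
qed

text \<open>The derivative of a series with coefficients \<open>O(1/n)\<close> is dominated by
  \<open>B * (\<Sum>n. norm z ^ n) = B / (1 - norm z)\<close>, which is exactly the growth that the
  Bloch seminorm allows.\<close>

lemma bloch_of_coeffs:
  fixes g :: "nat \<Rightarrow> complex"
  assumes G: "\<And>z. norm z < 1 \<Longrightarrow> (\<lambda>n. g n * z ^ n) sums G z"
    and g: "\<And>n. norm (g n) \<le> B / (real n + 1)"
  shows "G \<in> bloch" "bloch_norm G \<le> 3 * B"
proof -
  have B: "B \<ge> 0" using order_trans[OF norm_ge_zero g[of 0]] by simp
  have le: "(1 - (norm z)\<^sup>2) * norm (deriv G z) \<le> 2 * B" if z: "norm z < 1" for z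
  proof -
    have geo: "(\<lambda>n. B * norm z ^ n) sums (B * (1 / (1 - norm z)))"
      using z by (intro sums_mult geometric_sums) auto
    have coeff_le: "norm (of_nat (Suc n) * g (Suc n) * z ^ n) \<le> B * norm z ^ n" for n
    proof -
      have "real (Suc n) * norm (g (Suc n)) \<le> real (Suc n) * (B / (real (Suc n) + 1))"
        using g[of "Suc n"] by (intro mult_left_mono) auto
      also have "\<dots> \<le> B" using B by (simp add: field_simps)
      finally show ?thesis by (simp add: norm_mult norm_power mult_right_mono del: of_nat_Suc)
    qed
    have "norm (deriv G z) \<le> (\<Sum>n. B * norm z ^ n)"
      using norm_suminf_le[OF coeff_le sums_summable[OF geo]]
        sums_unique[OF deriv_power_series_disk[OF G z]] by simp
    also have "\<dots> = B / (1 - norm z)" using sums_unique[OF geo] by simp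
    finally have "(1 - (norm z)\<^sup>2) * norm (deriv G z) \<le> (1 - (norm z)\<^sup>2) * (B / (1 - norm z))"
      using z by (intro mult_left_mono) (auto simp: power_le_one)
    also have "\<dots> = (1 + norm z) * B"
      using z by (simp add: power2_eq_square field_simps)
    also have "\<dots> \<le> 2 * B" using z B by (intro mult_right_mono) auto
    finally show ?thesis .
  qed
  have "G holomorphic_on ball 0 1"
    by (rule power_series_holomorphic[where a = g]) (use G in simp)
  moreover have "bdd_above ((\<lambda>z. (1 - (norm z)\<^sup>2) * norm (deriv G z)) ` ball 0 1)"
    using le by (intro bdd_aboveI2[where M = "2 * B"]) auto
  ultimately show "G \<in> bloch" by (simp add: bloch_def)
  have "G 0 = g 0" using sums_unique2[OF G[of 0] powser_sums_zero] by simp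
  moreover have "(SUP z\<in>ball 0 1. (1 - (norm z)\<^sup>2) * norm (deriv G z)) \<le> 2 * B"
    using le by (intro cSUP_least) auto
  ultimately show "bloch_norm G \<le> 3 * B"
    using g[of 0] by (simp add: bloch_norm_def)
qed

text \<open>The moment estimate with \<open>s - a = \<alpha> + 1\<close> contributes
  \<open>fact n / Gamma (n + 2 + \<alpha>)\<close>, the binomial coefficient
  \<open>Gamma (n + 1 + \<alpha>) / fact n\<close>, so only \<open>1 / (n + 1 + \<alpha>)\<close>
  survives.\<close>

lemma kernel_coeff_bound:
  assumes \<alpha>: "\<alpha> > -1" and sets: "sets \<mu> = sets (restrict_space borel {0..<1::real})"
    and a: "0 \<le> a" and carl: "carleson (a + \<alpha> + 1) \<mu>"
  obtains B where "B \<ge> 0"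
    "\<And>\<phi> K n. K \<ge> 0 \<Longrightarrow> (\<And>t. 0 \<le> t \<Longrightarrow> t < 1 \<Longrightarrow> norm (\<phi> t) \<le> K * (1 - t) powr (-a)) \<Longrightarrow>
      norm (of_real (binom_coeff \<alpha> n) * (LINT t|\<mu>. of_real (t ^ n) * \<phi> t) :: complex) \<le> K * B / (real n + 1)"
proof -
  have space: "space \<mu> = {0..<1}" by (rule space_unit_interval[OF sets])
  obtain C where C: "C > 0" and int: "\<And>n. integrable \<mu> (\<lambda>t. t ^ n * (1 - t) powr (-a))"
    and le: "\<And>n. (LINT t|\<mu>. t ^ n * (1 - t) powr (-a)) \<le> C * (fact n / Gamma (real n + 1 + (a + \<alpha> + 1 - a)))"
    using carleson_integrable_powr[OF sets carl a] \<alpha> by auto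
  \<comment> \<open>The factor \<open>d\<close> compares \<open>n + 1 + \<alpha>\<close> with \<open>n + 1\<close>; it matters for negative \<open>\<alpha>\<close>.\<close>
  define d where "d = min 1 (\<alpha> + 1)"
  have d: "d > 0" "d \<le> 1" "d \<le> \<alpha> + 1" using \<alpha> by (auto simp: d_def)
  define B where "B = C / (Gamma (\<alpha> + 1) * d)"
  have G: "Gamma (\<alpha> + 1) > 0" using \<alpha> by (intro Gamma_real_pos) auto
  have B: "B \<ge> 0" using C d G by (simp add: B_def)
  moreover have "norm (of_real (binom_coeff \<alpha> n) * (LINT t|\<mu>. of_real (t ^ n) * \<phi> t) :: complex) \<le> K * B / (real n + 1)"
    if K: "K \<ge> 0" and \<phi>: "\<And>t. 0 \<le> t \<Longrightarrow> t < 1 \<Longrightarrow> norm (\<phi> t) \<le> K * (1 - t) powr (-a)" for \<phi> K n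
  proof -
    have "norm (LINT t|\<mu>. complex_of_real (t ^ n) * \<phi> t) \<le> (LINT t|\<mu>. norm (complex_of_real (t ^ n) * \<phi> t))"
      by (rule integral_norm_bound)
    also have "\<dots> \<le> (LINT t|\<mu>. K * (t ^ n * (1 - t) powr (-a)))"
    proof (rule integral_mono')
      show "integrable \<mu> (\<lambda>t. K * (t ^ n * (1 - t) powr (-a)))"
        using int by (intro integrable_mult_right)
      fix t assume "t \<in> space \<mu>"
      then have t: "0 \<le> t" "t < 1" using space by auto
      show "0 \<le> K * (t ^ n * (1 - t) powr (-a))" using K t by simp
      have "norm (complex_of_real (t ^ n) * \<phi> t) = t ^ n * norm (\<phi> t)"
        using t by (simp add: norm_mult norm_power)
      also have "\<dots> \<le> t ^ n * (K * (1 - t) powr (-a))"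
        using t by (intro mult_left_mono \<phi>) auto
      finally show "norm (complex_of_real (t ^ n) * \<phi> t) \<le> K * (t ^ n * (1 - t) powr (-a))"
        by (simp add: mult_ac)
    qed
    also have "\<dots> \<le> K * (C * (fact n / Gamma (real n + 1 + (\<alpha> + 1))))"
    proof -
      have "a + \<alpha> + 1 - a = \<alpha> + 1" by simp
      then have "(LINT t|\<mu>. t ^ n * (1 - t) powr (-a)) \<le> C * (fact n / Gamma (real n + 1 + (\<alpha> + 1)))"
        using le[of n] by (simp only:)
      then show ?thesis using K unfolding integral_mult_right_zero by (rule mult_left_mono)
    qed
    finally have "binom_coeff \<alpha> n * norm (LINT t|\<mu>. complex_of_real (t ^ n) * \<phi> t)
       \<le> binom_coeff \<alpha> n * (K * (C * (fact n / Gamma (real n + 1 + (\<alpha> + 1)))))"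
      using binom_coeff_pos[OF \<alpha>, of n] by (intro mult_left_mono) auto
    then have "norm (of_real (binom_coeff \<alpha> n) * (LINT t|\<mu>. of_real (t ^ n) * \<phi> t) :: complex)
       \<le> binom_coeff \<alpha> n * (K * (C * (fact n / Gamma (real n + 1 + (\<alpha> + 1)))))"
      using binom_coeff_pos[OF \<alpha>, of n] by (simp only: norm_mult norm_of_real abs_of_pos)
    also have "\<dots> = K * C / (Gamma (\<alpha> + 1) * (real n + 1 + \<alpha>))"
    proof -
      have "Gamma (real n + 1 + \<alpha>) > 0" using \<alpha> by (intro Gamma_real_pos) auto
      then have pos: "Gamma (real n + 1 + \<alpha>) \<noteq> 0" by simp
      have "Gamma (real n + 1 + (\<alpha> + 1)) = (real n + 1 + \<alpha>) * Gamma (real n + 1 + \<alpha>)"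
        using \<alpha> Gamma_plus1[of "real n + 1 + \<alpha>"] by (force elim!: nonpos_Ints_cases simp: add_ac)
      moreover have "Gamma (real n + 1) = fact n"
        using Gamma_fact[of n, where 'a = real] by (simp add: add.commute)
      ultimately show ?thesis using pos G \<alpha> by (simp add: binom_coeff_def)
    qed
    also have "\<dots> \<le> K * C / (Gamma (\<alpha> + 1) * (d * (real n + 1)))"
    proof (intro divide_left_mono mult_left_mono mult_pos_pos)
      have "d * real n \<le> 1 * real n" using d by (intro mult_right_mono) auto
      then show "d * (real n + 1) \<le> real n + 1 + \<alpha>" using d by (simp add: distrib_left)
    qed (use K C G d \<alpha> in auto)
    also have "\<dots> = K * B / (real n + 1)" by (simp add: B_def)
    finally show ?thesis .
  qed
  ultimately show ?thesis using that by blast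
qed

lemma bounded_bergman_blochI:
  assumes "\<And>f. f \<in> bergman p \<Longrightarrow> wd f" "\<And>f. f \<in> bergman p \<Longrightarrow> T f \<in> bloch" and "C \<ge> 0"
    "\<And>f. f \<in> bergman p \<Longrightarrow> bloch_norm (T f) \<le> C * bergman_norm p f"
  shows "bounded_bergman_bloch p wd T"
proof -
  \<comment> \<open>The constant in the definition has to be strictly positive.\<close>
  have "bloch_norm (T f) \<le> (C + 1) * bergman_norm p f" if "f \<in> bergman p" for f
  proof -
    have "bergman_norm p f \<ge> 0" by (simp add: bergman_norm_def)
    then show ?thesis using assms(4)[OF that] by (simp add: distrib_right)
  qed
  moreover have "C + 1 > 0" using assms(3) by simp
  ultimately show ?thesis
    unfolding bounded_bergman_bloch_def using assms(1,2) by blast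
qed

text \<open>Both operators are covered by the same coefficient bound, applied to \<open>f t\<close> and to
  \<open>norm (f t)\<close>.\<close>

lemma carleson_imp_bounded:
  assumes p: "p > 0" and \<alpha>: "\<alpha> > -1" and sets: "sets \<mu> = sets (restrict_space borel {0..<1::real})"
    and carl: "carleson (2 / p + \<alpha> + 1) \<mu>"
  shows "bounded_bergman_bloch p (hankel_well_defined \<mu> \<alpha>) (hankel_op \<mu> \<alpha>)"
    and "bounded_bergman_bloch p (integral_well_defined \<mu> \<alpha>) (integral_op \<mu> \<alpha>)"
proof -
  have a: "0 \<le> 2 / p" "2 / p < 2 / p + \<alpha> + 1" using p \<alpha> by auto
  obtain C where C: "C > 0" and growth: "\<And>f z. f \<in> bergman p \<Longrightarrow> norm z < 1 \<Longrightarrow>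
      norm (f z) \<le> C * bergman_norm p f * (1 - norm z) powr (-(2 / p))"
    using bergman_growth[OF p] by blast
  obtain B where B: "B \<ge> 0" and coeff:
    "\<And>\<phi> K n. K \<ge> 0 \<Longrightarrow> (\<And>t. 0 \<le> t \<Longrightarrow> t < 1 \<Longrightarrow> norm (\<phi> t) \<le> K * (1 - t) powr (-(2 / p))) \<Longrightarrow>
      norm (of_real (binom_coeff \<alpha> n) * (LINT t|\<mu>. of_real (t ^ n) * \<phi> t) :: complex) \<le> K * B / (real n + 1)"
    using kernel_coeff_bound[OF \<alpha> sets a(1) carl] by blast
  have CB: "3 * (C * B) \<ge> 0" using C B by simp
  have K: "C * bergman_norm p f \<ge> 0" for f using C by (simp add: bergman_norm_def)
  have real_growth: "norm (f (of_real t)) \<le> C * bergman_norm p f * (1 - t) powr (-(2 / p))"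
    if "f \<in> bergman p" "0 \<le> t" "t < 1" for f t
    using growth[OF that(1), of "of_real t"] that by simp
  have hol: "f holomorphic_on ball 0 1" if "f \<in> bergman p" for f using that by (simp add: bergman_def)
  have Hb: "norm (of_real (binom_coeff \<alpha> n) * (LINT t|\<mu>. of_real (t ^ n) * f (of_real t))) \<le> C * bergman_norm p f * B / (real n + 1)"
    if "f \<in> bergman p" for f n
    by (rule coeff[OF K real_growth[OF that]])
  have Ib: "norm (of_real (binom_coeff \<alpha> n) * (LINT t|\<mu>. of_real (t ^ n) * complex_of_real (norm (f (of_real t))))) \<le> C * bergman_norm p f * B / (real n + 1)"
    if "f \<in> bergman p" for f n
    by (rule coeff[OF K]) (simp add: real_growth[OF that])
  show "bounded_bergman_bloch p (hankel_well_defined \<mu> \<alpha>) (hankel_op \<mu> \<alpha>)"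
  proof (rule bounded_bergman_blochI[OF _ _ CB])
    fix f assume f: "f \<in> bergman p"
    note rep = hankel_term_sums[OF sets carl a hol[OF f] K growth[OF f]]
    note H = hankel_op_sums[OF \<alpha> sets rep]
    show "hankel_well_defined \<mu> \<alpha> f" by (rule H(1))
    show "hankel_op \<mu> \<alpha> f \<in> bloch"
      by (rule bloch_of_coeffs(1)[OF H(2) Hb[OF f]])
    have "bloch_norm (hankel_op \<mu> \<alpha> f) \<le> 3 * (C * bergman_norm p f * B)"
      by (rule bloch_of_coeffs(2)[OF H(2) Hb[OF f]])
    then show "bloch_norm (hankel_op \<mu> \<alpha> f) \<le> 3 * (C * B) * bergman_norm p f" by (simp add: mult_ac)
  qed
  show "bounded_bergman_bloch p (integral_well_defined \<mu> \<alpha>) (integral_op \<mu> \<alpha>)"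
  proof (rule bounded_bergman_blochI[OF _ _ CB])
    fix f assume f: "f \<in> bergman p"
    note I = integral_op_sums[OF \<alpha> sets hankel_term_sums(1)[OF sets carl a hol[OF f] K growth[OF f]]]
    show "integral_well_defined \<mu> \<alpha> f"
      using I(1) by (auto simp: integral_well_defined_def)
    show "integral_op \<mu> \<alpha> f \<in> bloch"
      by (rule bloch_of_coeffs(1)[OF I(2) Ib[OF f]])
    have "bloch_norm (integral_op \<mu> \<alpha> f) \<le> 3 * (C * bergman_norm p f * B)"
      by (rule bloch_of_coeffs(2)[OF I(2) Ib[OF f]])
    then show "bloch_norm (integral_op \<mu> \<alpha> f) \<le> 3 * (C * B) * bergman_norm p f" by (simp add: mult_ac)
  qed
qed

section \<open>Test functions: necessity of the Carleson condition\<close>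

lemma nn_integral_Cauchy_density:
  fixes \<delta> c t :: real
  assumes \<delta>: "\<delta> > 0" and c: "c \<noteq> 0"
  shows "(\<integral>\<^sup>+x. ennreal (1 / (\<delta>\<^sup>2 + (t + c * x)\<^sup>2)) \<partial>lborel) = ennreal (pi / (\<delta> * \<bar>c\<bar>))"
proof -
  define g where "g = (\<lambda>x::real. ennreal (1 / (1 + x\<^sup>2)))"
  have [measurable]: "g \<in> borel_measurable borel" unfolding g_def by measurable
  have half: "(\<integral>\<^sup>+x. g x * indicator {0..} x \<partial>lborel) = ennreal (pi / 2)"
  proof -
    have "(\<integral>\<^sup>+x. ennreal (1 / (1 + x\<^sup>2)) * indicator {0..} x \<partial>lborel) = ennreal (pi / 2 - arctan 0)"
      by (intro nn_integral_FTC_atLeast)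
         (auto intro!: derivative_eq_intros tendsto_arctan_at_top simp: field_simps)
    then show ?thesis by (simp add: g_def)
  qed
  have "(\<integral>\<^sup>+x. g x \<partial>lborel) = (\<integral>\<^sup>+x. g x * indicator {0..} x + g x * indicator {..0} x \<partial>lborel)"
    using AE_lborel_singleton[of "0::real"]
    by (intro nn_integral_cong_AE, elim eventually_mono) (auto split: split_indicator)
  also have "\<dots> = (\<integral>\<^sup>+x. g x * indicator {0..} x \<partial>lborel) + (\<integral>\<^sup>+x. g x * indicator {..0} x \<partial>lborel)"
    by (rule nn_integral_add) auto
  also have "(\<integral>\<^sup>+x. g x * indicator {..0} x \<partial>lborel) = (\<integral>\<^sup>+x. g x * indicator {0..} x \<partial>lborel)"
  proof -
    have "(\<integral>\<^sup>+x. g x * indicator {..0} x \<partial>lborel) = ennreal \<bar>-1\<bar> * (\<integral>\<^sup>+x. g (0 + (-1) * x) * indicator {..0} (0 + (-1) * x) \<partial>lborel)"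
      by (rule nn_integral_real_affine) auto
    also have "(\<integral>\<^sup>+x. g (0 + (-1) * x) * indicator {..0} (0 + (-1) * x) \<partial>lborel) = (\<integral>\<^sup>+x. g x * indicator {0..} x \<partial>lborel)"
      by (intro nn_integral_cong) (auto simp: g_def split: split_indicator)
    finally show ?thesis by simp
  qed
  finally have Jsum: "(\<integral>\<^sup>+x. g x \<partial>lborel) = (\<integral>\<^sup>+x. g x * indicator {0..} x \<partial>lborel) + (\<integral>\<^sup>+x. g x * indicator {0..} x \<partial>lborel)" .
  then have J: "(\<integral>\<^sup>+x. g x \<partial>lborel) = ennreal pi"
  proof -
    have "ennreal (pi / 2) + ennreal (pi / 2) = ennreal pi"
      by (subst ennreal_plus[symmetric]) auto
    then show ?thesis using Jsum unfolding half by simp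
  qed
  have "ennreal pi = ennreal \<bar>c / \<delta>\<bar> * (\<integral>\<^sup>+x. g (t / \<delta> + c / \<delta> * x) \<partial>lborel)"
    using J \<delta> c nn_integral_real_affine[of g "c / \<delta>" "t / \<delta>"] by simp
  also have "(\<integral>\<^sup>+x. g (t / \<delta> + c / \<delta> * x) \<partial>lborel) = (\<integral>\<^sup>+x. ennreal (\<delta>\<^sup>2) * ennreal (1 / (\<delta>\<^sup>2 + (t + c * x)\<^sup>2)) \<partial>lborel)"
  proof (intro nn_integral_cong)
    fix x
    have "1 + (t / \<delta> + c / \<delta> * x)\<^sup>2 = (\<delta>\<^sup>2 + (t + c * x)\<^sup>2) / \<delta>\<^sup>2"
      using \<delta> by (simp add: field_simps power2_eq_square)
    then show "g (t / \<delta> + c / \<delta> * x) = ennreal (\<delta>\<^sup>2) * ennreal (1 / (\<delta>\<^sup>2 + (t + c * x)\<^sup>2))"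
      using \<delta> unfolding g_def by (subst ennreal_mult[symmetric]) auto
  qed
  also have "\<dots> = ennreal (\<delta>\<^sup>2) * (\<integral>\<^sup>+x. ennreal (1 / (\<delta>\<^sup>2 + (t + c * x)\<^sup>2)) \<partial>lborel)"
    by (rule nn_integral_cmult) measurable
  finally have scaled: "ennreal pi = ennreal \<bar>c / \<delta>\<bar> * (ennreal (\<delta>\<^sup>2) * (\<integral>\<^sup>+x. ennreal (1 / (\<delta>\<^sup>2 + (t + c * x)\<^sup>2)) \<partial>lborel))" .
  then have eq: "ennreal pi = ennreal (\<delta> * \<bar>c\<bar>) * (\<integral>\<^sup>+x. ennreal (1 / (\<delta>\<^sup>2 + (t + c * x)\<^sup>2)) \<partial>lborel)" (is "_ = _ * ?I")
  proof -
    have "\<bar>c / \<delta>\<bar> * \<delta>\<^sup>2 = \<delta> * \<bar>c\<bar>" using \<delta> by (simp add: power2_eq_square abs_divide)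
    then have "ennreal \<bar>c / \<delta>\<bar> * ennreal (\<delta>\<^sup>2) = ennreal (\<delta> * \<bar>c\<bar>)"
      by (subst ennreal_mult[symmetric]) auto
    then show ?thesis using scaled by (simp only: mult.assoc[symmetric])
  qed
  have "ennreal (pi / (\<delta> * \<bar>c\<bar>)) = ennreal (1 / (\<delta> * \<bar>c\<bar>)) * ennreal pi"
    using \<delta> by (subst ennreal_mult[symmetric]) auto
  also have "\<dots> = ?I"
  proof -
    have "ennreal (1 / (\<delta> * \<bar>c\<bar>)) * ennreal (\<delta> * \<bar>c\<bar>) = 1"
      using \<delta> c by (subst ennreal_mult[symmetric]) auto
    then show ?thesis unfolding eq mult.assoc[symmetric] by simp
  qed
  finally show ?thesis by simp
qed

text \<open>Up to a unimodular factor, \<open>bergman_test p r\<close> is \<open>\<phi>'\<close> raised to the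
  power \<open>2/p\<close>, where \<open>\<phi>\<close> is the disk automorphism that moves
  \<open>r\<close> to \<open>0\<close>. Hence \<open>norm (bergman_test p r z) powr p\<close> is the
  Jacobian of \<open>\<phi>\<close>, whose area integral over the disk does not depend on
  \<open>r\<close>.\<close>

definition bergman_test :: "real \<Rightarrow> real \<Rightarrow> complex \<Rightarrow> complex" where
  "bergman_test p r z = of_real ((1 - r\<^sup>2) powr (2 / p)) * (1 - of_real r * z) powr of_real (- (4 / p))"

lemma one_minus_mult_pos_Re:
  fixes z :: complex
  assumes "0 \<le> r" "r < 1" "norm z < 1"
  shows "0 < Re (1 - of_real r * z)"
proof -
  have "\<bar>Re (of_real r * z)\<bar> \<le> norm (of_real r * z)" by (rule abs_Re_le_cmod)
  also have "\<dots> < 1" using assms mult_strict_mono'[of r 1 "norm z" 1] by (simp add: norm_mult)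
  finally show ?thesis by simp
qed

lemma bergman_test_holomorphic:
  assumes "0 \<le> r" "r < 1"
  shows "bergman_test p r holomorphic_on ball 0 1"
proof -
  have "1 - of_real r * z \<notin> \<real>\<^sub>\<le>\<^sub>0" if "z \<in> ball 0 1" for z :: complex
    using one_minus_mult_pos_Re[OF assms, of z] that by (auto simp: complex_nonpos_Reals_iff)
  then show ?thesis
    unfolding bergman_test_def by (intro holomorphic_intros) auto
qed

lemma norm_bergman_test:
  "norm (bergman_test p r z) = \<bar>(1 - r\<^sup>2) powr (2 / p)\<bar> * norm (1 - of_real r * z) powr (- (4 / p))"
  by (simp add: bergman_test_def norm_mult norm_powr_real_powr' del: of_real_minus)

text \<open>Bounding the fourth power from below by a product of a function of \<open>Re z\<close> and a
  function of \<open>Im z\<close> lets Tonelli reduce the norm of the test function to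
  one-dimensional integrals. The summands \<open>(1 - r)\<^sup>2\<close>, which make these integrals
  converge, are available because \<open>norm (1 - r * z) \<ge> 1 - r\<close> on the disk.\<close>

lemma norm_one_minus_power4_ge:
  assumes r: "0 \<le> r" "r < 1" and z: "norm z < 1"
  shows "((1 - r)\<^sup>2 + (1 - r * Re z)\<^sup>2) * ((1 - r)\<^sup>2 + (r * Im z)\<^sup>2) \<le> 4 * norm (1 - of_real r * z) ^ 4"
proof -
  define w where "w = (norm (1 - of_real r * z))\<^sup>2"
  have w: "w = (1 - r * Re z)\<^sup>2 + (r * Im z)\<^sup>2" by (simp add: w_def cmod_power2)
  have "1 - r \<le> norm (1 - of_real r * z)"
  proof -
    have "r * norm z \<le> r * 1" using r z by (intro mult_left_mono) auto
    then show ?thesis using norm_triangle_ineq2[of 1 "of_real r * z"] r by (simp add: norm_mult)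
  qed
  then have d: "(1 - r)\<^sup>2 \<le> w" unfolding w_def using r by (intro power_mono) auto
  have sum2: "c + a \<le> 2 * (a + b)" "c + b \<le> 2 * (a + b)" if "c \<le> a + b" "0 \<le> a" "0 \<le> b" for a b c :: real
    using that by auto
  have "((1 - r)\<^sup>2 + (1 - r * Re z)\<^sup>2) * ((1 - r)\<^sup>2 + (r * Im z)\<^sup>2) \<le> (2 * w) * (2 * w)"
  proof (rule mult_mono)
    show "(1 - r)\<^sup>2 + (1 - r * Re z)\<^sup>2 \<le> 2 * w" "(1 - r)\<^sup>2 + (r * Im z)\<^sup>2 \<le> 2 * w"
      using sum2[OF d[unfolded w]] unfolding w by auto
  qed (auto simp: w)
  also have "\<dots> = 4 * norm (1 - of_real r * z) ^ 4"
    by (simp only: w_def power2_eq_square power4_eq_xxxx mult_ac numeral_times_numeral mult.left_commute)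
  finally show ?thesis .
qed

text \<open>Extending the integral from the disk to the whole plane loses only a constant factor, because
  \<open>norm (1 - r * z) powr -4\<close> is concentrated at distance about \<open>1 - r\<close>
  from the point \<open>1\<close>.\<close>

lemma bergman_test_bound:
  assumes p: "p > 0" and r: "1 / 2 \<le> r" "r < 1"
  shows "bergman_test p r \<in> bergman p" "bergman_norm p (bergman_test p r) \<le> (64 * pi) powr (1 / p)"
proof -
  have r0: "0 \<le> r" using r by simp
  have hol: "bergman_test p r holomorphic_on ball 0 1" using r by (intro bergman_test_holomorphic) auto
  define \<delta> where "\<delta> = 1 - r"
  have \<delta>: "\<delta> > 0" using r by (simp add: \<delta>_def)
  have r2: "1 - r\<^sup>2 > 0" "1 - r\<^sup>2 \<le> 2 * \<delta>"
  proof -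
    have eq: "1 - r\<^sup>2 = (1 + r) * \<delta>" by (simp add: \<delta>_def power2_eq_square algebra_simps)
    show "1 - r\<^sup>2 > 0" unfolding eq using r \<delta> by simp
    show "1 - r\<^sup>2 \<le> 2 * \<delta>" unfolding eq using r \<delta> by (intro mult_right_mono) auto
  qed
  define G where "G = (\<lambda>z. indicator (ball 0 1) z *\<^sub>R (norm (bergman_test p r z) powr p))"
  have [measurable]: "G \<in> borel_measurable borel"
    unfolding G_def
    by (intro borel_measurable_continuous_on_indicator continuous_on_powr' continuous_on_norm
        holomorphic_on_imp_continuous_on[OF hol] continuous_on_const) (use p in auto)
  have G_le: "ennreal (G z) \<le> ennreal (16 * \<delta>\<^sup>2) * (ennreal (1 / (\<delta>\<^sup>2 + (1 + (-r) * Re z)\<^sup>2)) * ennreal (1 / (\<delta>\<^sup>2 + (0 + r * Im z)\<^sup>2)))" for z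
  proof (cases "norm z < 1")
    case True
    define N where "N = norm (1 - of_real r * z)"
    have N: "N > 0" unfolding N_def zero_less_norm_iff
      using one_minus_mult_pos_Re[OF r0 r(2) True] by (metis less_irrefl zero_complex.sel(1))
    have A: "\<delta>\<^sup>2 + (1 - r * Re z)\<^sup>2 > 0" "\<delta>\<^sup>2 + (r * Im z)\<^sup>2 > 0"
      using \<delta> by (auto intro!: add_pos_nonneg)
    have "G z = ((1 - r\<^sup>2) powr (2 / p) * N powr (- (4 / p))) powr p"
      using True r2 by (simp add: G_def norm_bergman_test N_def)
    also have "\<dots> = (1 - r\<^sup>2) powr 2 * N powr (- 4)"
      using p by (simp add: powr_mult powr_powr)
    also have "\<dots> = (1 - r\<^sup>2)\<^sup>2 * (1 / N ^ 4)"
      using r2 N by (simp add: powr_minus powr_numeral inverse_eq_divide)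
    also have "\<dots> \<le> (2 * \<delta>)\<^sup>2 * (4 / ((\<delta>\<^sup>2 + (1 - r * Re z)\<^sup>2) * (\<delta>\<^sup>2 + (r * Im z)\<^sup>2)))"
    proof (intro mult_mono power_mono r2)
      have "(\<delta>\<^sup>2 + (1 - r * Re z)\<^sup>2) * (\<delta>\<^sup>2 + (r * Im z)\<^sup>2) \<le> 4 * N ^ 4"
        unfolding \<delta>_def N_def by (rule norm_one_minus_power4_ge[OF r0 r(2) True])
      then show "1 / N ^ 4 \<le> 4 / ((\<delta>\<^sup>2 + (1 - r * Re z)\<^sup>2) * (\<delta>\<^sup>2 + (r * Im z)\<^sup>2))"
        using N A divide_left_mono[of "(\<delta>\<^sup>2 + (1 - r * Re z)\<^sup>2) * (\<delta>\<^sup>2 + (r * Im z)\<^sup>2)" "4 * N ^ 4" 4]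
        by (simp del: mult_pos_pos add: mult_pos_pos)
    qed (use r2 \<delta> N A in auto)
    also have "\<dots> = 16 * \<delta>\<^sup>2 * (1 / (\<delta>\<^sup>2 + (1 - r * Re z)\<^sup>2) * (1 / (\<delta>\<^sup>2 + (r * Im z)\<^sup>2)))"
      by (simp add: power_mult_distrib)
    finally have "ennreal (G z) \<le> ennreal (16 * \<delta>\<^sup>2 * (1 / (\<delta>\<^sup>2 + (1 - r * Re z)\<^sup>2) * (1 / (\<delta>\<^sup>2 + (r * Im z)\<^sup>2))))"
      by (rule ennreal_leI)
    also have "\<dots> = ennreal (16 * \<delta>\<^sup>2) * (ennreal (1 / (\<delta>\<^sup>2 + (1 - r * Re z)\<^sup>2)) * ennreal (1 / (\<delta>\<^sup>2 + (r * Im z)\<^sup>2)))"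
      using A by (subst ennreal_mult, simp, simp)+ auto
    finally show ?thesis by simp
  qed (simp add: G_def)
  have "(\<integral>\<^sup>+z. ennreal (G z) \<partial>lborel) \<le> (\<integral>\<^sup>+z. ennreal (16 * \<delta>\<^sup>2) * (ennreal (1 / (\<delta>\<^sup>2 + (1 + (-r) * Re z)\<^sup>2)) * ennreal (1 / (\<delta>\<^sup>2 + (0 + r * Im z)\<^sup>2))) \<partial>lborel)"
    by (intro nn_integral_mono G_le)
  also have "\<dots> = (\<integral>\<^sup>+x. \<integral>\<^sup>+y. ennreal (16 * \<delta>\<^sup>2) * (ennreal (1 / (\<delta>\<^sup>2 + (1 + (-r) * x)\<^sup>2)) * ennreal (1 / (\<delta>\<^sup>2 + (0 + r * y)\<^sup>2))) \<partial>lborel \<partial>lborel)"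
    by (subst nn_integral_lborel_complex(1)) auto
  also have "\<dots> = ennreal (16 * \<delta>\<^sup>2) * (ennreal (pi / (\<delta> * r)) * ennreal (pi / (\<delta> * r)))"
    using nn_integral_Cauchy_density[OF \<delta>, of "-r" 1] nn_integral_Cauchy_density[OF \<delta>, of r 0] r
    by (simp add: nn_integral_cmult nn_integral_multc)
  also have "\<dots> = ennreal (16 * \<delta>\<^sup>2 * (pi / (\<delta> * r) * (pi / (\<delta> * r))))"
    using \<delta> r by (subst ennreal_mult, simp, simp)+ auto
  also have "16 * \<delta>\<^sup>2 * (pi / (\<delta> * r) * (pi / (\<delta> * r))) = 16 * pi\<^sup>2 / r\<^sup>2"
    using \<delta> r by (simp add: power2_eq_square)
  also have "ennreal (16 * pi\<^sup>2 / r\<^sup>2) \<le> ennreal (64 * pi\<^sup>2)"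
  proof (intro ennreal_leI)
    have "(1 / 2)\<^sup>2 \<le> r\<^sup>2" using r by (intro power_mono) auto
    then have "16 * pi\<^sup>2 * 1 \<le> 16 * pi\<^sup>2 * (4 * r\<^sup>2)" by (intro mult_left_mono) (auto simp: power2_eq_square)
    then show "16 * pi\<^sup>2 / r\<^sup>2 \<le> 64 * pi\<^sup>2"
      using r by (simp add: divide_le_eq)
  qed
  finally have le: "(\<integral>\<^sup>+z. ennreal (G z) \<partial>lborel) \<le> ennreal (64 * pi\<^sup>2)" .
  have int: "integrable lborel G"
  proof (rule integrableI_nonneg)
    show "AE z in lborel. 0 \<le> G z" by (simp add: G_def)
    show "(\<integral>\<^sup>+z. ennreal (G z) \<partial>lborel) < \<infinity>"
      using order.strict_trans1[OF le ennreal_less_top] by simp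
  qed measurable
  then show "bergman_test p r \<in> bergman p"
    using hol by (simp add: bergman_def set_integrable_def G_def)
  have "ennreal (LINT z|lborel. G z) \<le> ennreal (64 * pi\<^sup>2)"
    using le nn_integral_eq_integral[OF int] by (simp add: G_def)
  then have *: "(LINT z|lborel. G z) \<le> 64 * pi\<^sup>2" by simp
  have "(LINT z|lborel. G z) / pi \<le> 64 * pi"
    using divide_right_mono[OF *, of pi] by (simp add: power2_eq_square)
  moreover have "(LINT z|lborel. G z) \<ge> 0"
    by (rule Bochner_Integration.integral_nonneg) (auto simp: G_def)
  ultimately have "((LINT z|lborel. G z) / pi) powr (1 / p) \<le> (64 * pi) powr (1 / p)"
    using p by (intro powr_mono2) auto
  then show "bergman_norm p (bergman_test p r) \<le> (64 * pi) powr (1 / p)"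
    by (simp add: bergman_norm_def set_lebesgue_integral_def G_def)
qed

lemma Suc_times_binom_coeff:
  assumes "\<alpha> > -1"
  shows "real (Suc n) * binom_coeff \<alpha> (Suc n) = (\<alpha> + 1) * binom_coeff (\<alpha> + 1) n"
proof -
  have "Gamma (real (Suc n) + 1) = real (Suc n) * Gamma (real n + 1)"
    using Gamma_plus1[of "real (Suc n)"] by (force elim!: nonpos_Ints_cases simp: add.commute)
  moreover have "Gamma (\<alpha> + 1 + 1) = (\<alpha> + 1) * Gamma (\<alpha> + 1)"
    using assms by (intro Gamma_plus1) (auto elim!: nonpos_Ints_cases)
  moreover have "real (Suc n) + 1 + \<alpha> = real n + 1 + (\<alpha> + 1)" by simp
  moreover have "S * (X / ((S * Y) * Z)) = A * (X / (Y * (A * Z)))" if "S \<noteq> 0" "A \<noteq> 0" for S A X Y Z :: real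
    using that by simp
  ultimately show ?thesis
    using assms unfolding binom_coeff_def by (simp only:)
qed

text \<open>With nonnegative coefficients the derivative at the real point \<open>r\<close> can be compared
  term by term with that of \<open>\<kappa> * (1 - r * z) powr -(\<alpha> + 1)\<close>, whose
  derivative series is again binomial, now with exponent \<open>\<alpha> + 2\<close>.\<close>

lemma bloch_norm_ge_of_coeffs:
  assumes \<alpha>: "\<alpha> > -1" and r: "0 < r" "r < 1" and \<kappa>: "\<kappa> \<ge> 0"
    and G: "\<And>z. norm z < 1 \<Longrightarrow> (\<lambda>n. complex_of_real (\<gamma> n) * z ^ n) sums G z" and bloch: "G \<in> bloch"
    and \<gamma>: "\<And>n. \<kappa> * (binom_coeff \<alpha> n * r ^ n) \<le> \<gamma> n"
  shows "\<kappa> * (r * (\<alpha> + 1) * (1 - r\<^sup>2) powr (-(\<alpha> + 1))) \<le> bloch_norm G"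
proof -
  have r2: "0 \<le> r\<^sup>2" "r\<^sup>2 < 1" using r by (auto simp: power_less_one_iff)
  define z where "z = complex_of_real r"
  have z: "norm z < 1" using r by (simp add: z_def)
  have "(\<lambda>n. of_nat (Suc n) * complex_of_real (\<gamma> (Suc n)) * z ^ n) sums deriv G z"
    by (rule deriv_power_series_disk[OF G z])
  then have "(\<lambda>n. complex_of_real (real (Suc n) * \<gamma> (Suc n) * r ^ n)) sums deriv G z"
    by (simp add: z_def)
  from sums_Re[OF this] have D: "(\<lambda>n. real (Suc n) * \<gamma> (Suc n) * r ^ n) sums Re (deriv G z)"
    by (simp only: Re_complex_of_real)
  have "(\<lambda>n. \<kappa> * r * ((\<alpha> + 1) * (binom_coeff (\<alpha> + 1) n * (r\<^sup>2) ^ n))) sums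
      (\<kappa> * r * ((\<alpha> + 1) * (1 - r\<^sup>2) powr -(\<alpha> + 1 + 1)))"
    using \<alpha> r2 by (intro sums_mult binom_coeff_sums_real) auto
  from this D have "\<kappa> * r * ((\<alpha> + 1) * (1 - r\<^sup>2) powr -(\<alpha> + 1 + 1)) \<le> Re (deriv G z)"
  proof (rule sums_le[rotated])
    fix n
    have "\<kappa> * r * ((\<alpha> + 1) * (binom_coeff (\<alpha> + 1) n * (r\<^sup>2) ^ n))
      = \<kappa> * r * ((real (Suc n) * binom_coeff \<alpha> (Suc n)) * (r\<^sup>2) ^ n)"
      by (simp only: Suc_times_binom_coeff[OF \<alpha>] mult.assoc)
    also have "\<dots> = (real (Suc n) * r ^ n) * (\<kappa> * (binom_coeff \<alpha> (Suc n) * r ^ Suc n))"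
      by (simp add: power2_eq_square power_mult_distrib mult_ac del: of_nat_Suc)
    also have "\<dots> \<le> (real (Suc n) * r ^ n) * \<gamma> (Suc n)"
      using r by (intro mult_left_mono \<gamma>) auto
    finally show "\<kappa> * r * ((\<alpha> + 1) * (binom_coeff (\<alpha> + 1) n * (r\<^sup>2) ^ n)) \<le> real (Suc n) * \<gamma> (Suc n) * r ^ n"
      by (simp add: mult_ac del: of_nat_Suc)
  qed
  also have "Re (deriv G z) \<le> norm (deriv G z)" by (rule complex_Re_le_cmod)
  finally have "(1 - r\<^sup>2) * (\<kappa> * r * ((\<alpha> + 1) * (1 - r\<^sup>2) powr -(\<alpha> + 1 + 1))) \<le> (1 - r\<^sup>2) * norm (deriv G z)"
    using r2 by (intro mult_left_mono) auto
  also have "(1 - r\<^sup>2) * norm (deriv G z) = (1 - (norm z)\<^sup>2) * norm (deriv G z)"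
    using r by (simp add: z_def)
  also have "\<dots> \<le> (SUP z\<in>ball 0 1. (1 - (norm z)\<^sup>2) * norm (deriv G z))"
    using bloch z by (intro cSUP_upper) (auto simp: bloch_def)
  also have "\<dots> \<le> bloch_norm G" by (simp add: bloch_norm_def)
  also have "(1 - r\<^sup>2) * (\<kappa> * r * ((\<alpha> + 1) * (1 - r\<^sup>2) powr -(\<alpha> + 1 + 1)))
    = \<kappa> * (r * (\<alpha> + 1) * (1 - r\<^sup>2) powr (-(\<alpha> + 1)))"
  proof -
    have "1 + -(\<alpha> + 1 + 1) = -(\<alpha> + 1)" by simp
    then have "(1 - r\<^sup>2) powr (-(\<alpha> + 1)) = (1 - r\<^sup>2) powr 1 * (1 - r\<^sup>2) powr -(\<alpha> + 1 + 1)"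
      using powr_add[of "1 - r\<^sup>2" 1 "-(\<alpha> + 1 + 1)"] by (simp only:)
    moreover have "(1 - r\<^sup>2) powr 1 = 1 - r\<^sup>2" using r2 by simp
    moreover have "X * (\<kappa> * r * ((\<alpha> + 1) * P)) = \<kappa> * (r * (\<alpha> + 1) * (X * P))" for X P
      by (simp only: mult_ac)
    ultimately show ?thesis by (simp only:)
  qed
  finally show ?thesis .
qed

lemma bergman_test_of_real:
  assumes "0 \<le> r" "r < 1" "0 \<le> t" "t < 1"
  shows "bergman_test p r (of_real t) = of_real ((1 - r\<^sup>2) powr (2 / p) * (1 - r * t) powr (-(4 / p)))"
proof -
  have "r * t \<le> 1 * t" using assms by (intro mult_right_mono) auto
  then have "0 \<le> 1 - r * t" using assms by linarith
  from powr_of_real[OF this, of "-(4 / p)"] show ?thesis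
    by (simp only: bergman_test_def of_real_mult of_real_diff of_real_1)
qed

text \<open>The trivial last factor gives the bound the form of a growth condition with exponent
  \<open>0\<close>.\<close>

lemma norm_bergman_test_le:
  assumes p: "p > 0" and r: "0 \<le> r" "r < 1" and z: "norm z < 1"
  shows "norm (bergman_test p r z) \<le> (1 - r\<^sup>2) powr (2 / p) * (1 - r) powr (-(4 / p)) * (1 - norm z) powr (- 0)"
proof -
  have "1 - r \<le> norm (1 - of_real r * z)"
  proof -
    have "r * norm z \<le> r * 1" using r z by (intro mult_left_mono) auto
    then show ?thesis using norm_triangle_ineq2[of 1 "of_real r * z"] r by (simp add: norm_mult)
  qed
  then have "norm (1 - of_real r * z) powr (-(4 / p)) \<le> (1 - r) powr (-(4 / p))"
    using r p by (intro powr_mono2') auto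
  then show ?thesis using z by (simp add: norm_bergman_test mult_left_mono)
qed

text \<open>A test function is bounded on the disk for fixed \<open>r\<close>, so the row sums are covered by
  the growth exponent \<open>0\<close>, for which every positive Carleson exponent suffices. As it
  is positive on \<open>[0,1)\<close>, taking absolute values changes nothing and the two operators
  have the same image.\<close>

lemma bergman_test_sums:
  assumes p: "p > 0" and \<alpha>: "\<alpha> > -1" and sets: "sets \<mu> = sets (restrict_space borel {0..<1::real})"
    and carl: "carleson s \<mu>" "0 < s" and r: "0 \<le> r" "r < 1" and z: "norm z < 1"
  defines "m \<equiv> \<lambda>n. LINT t|\<mu>. t ^ n * ((1 - r\<^sup>2) powr (2 / p) * (1 - r * t) powr (-(4 / p)))"
  shows "(\<lambda>n. complex_of_real (binom_coeff \<alpha> n * m n) * z ^ n) sums hankel_op \<mu> \<alpha> (bergman_test p r) z"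
    and "(\<lambda>n. complex_of_real (binom_coeff \<alpha> n * m n) * z ^ n) sums integral_op \<mu> \<alpha> (bergman_test p r) z"
proof -
  let ?f = "bergman_test p r"
  define \<tau> where "\<tau> = (\<lambda>t. (1 - r\<^sup>2) powr (2 / p) * (1 - r * t) powr (-(4 / p)))"
  have space: "space \<mu> = {0..<1}" by (rule space_unit_interval[OF sets])
  have f: "?f (of_real t) = of_real (\<tau> t)" if "t \<in> space \<mu>" for t
    using that space r unfolding \<tau>_def by (intro bergman_test_of_real) auto
  have \<tau>: "\<tau> t \<ge> 0" for t by (simp add: \<tau>_def)
  note rep = hankel_term_sums[OF sets carl(1) order.refl carl(2) bergman_test_holomorphic[OF r] _
      norm_bergman_test_le[OF p r]]
  have int: "integrable \<mu> (\<lambda>t. ?f (of_real t))" by (rule rep(1)) auto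
  have rep2: "hankel_term \<mu> ?f n sums (LINT t|\<mu>. of_real (t ^ n) * ?f (of_real t))" for n by (rule rep(2)) auto
  have "(LINT t|\<mu>. complex_of_real (t ^ n) * ?f (of_real t)) = (LINT t|\<mu>. complex_of_real (t ^ n * \<tau> t))" for n
    by (rule Bochner_Integration.integral_cong) (simp_all add: f)
  then have h: "(LINT t|\<mu>. complex_of_real (t ^ n) * ?f (of_real t)) = of_real (m n)" for n
    by (simp only: integral_complex_of_real m_def \<tau>_def)
  have "(LINT t|\<mu>. complex_of_real (t ^ n) * of_real (norm (?f (of_real t)))) = (LINT t|\<mu>. complex_of_real (t ^ n * \<tau> t))" for n
    by (rule Bochner_Integration.integral_cong) (simp_all add: f \<tau>)
  then have i: "(LINT t|\<mu>. complex_of_real (t ^ n) * of_real (norm (?f (of_real t)))) = of_real (m n)" for n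
    by (simp only: integral_complex_of_real m_def \<tau>_def)
  show "(\<lambda>n. complex_of_real (binom_coeff \<alpha> n * m n) * z ^ n) sums hankel_op \<mu> \<alpha> ?f z"
    using hankel_op_sums(2)[OF \<alpha> sets int rep2 z] unfolding h by (simp only: of_real_mult)
  show "(\<lambda>n. complex_of_real (binom_coeff \<alpha> n * m n) * z ^ n) sums integral_op \<mu> \<alpha> ?f z"
    using integral_op_sums(2)[OF \<alpha> sets int z] unfolding i by (simp only: of_real_mult)
qed

text \<open>On \<open>[r,1)\<close> the test function is at least its value
  \<open>(1 - r\<^sup>2) powr -(2/p)\<close> at \<open>r\<close>, and
  \<open>t ^ n \<ge> r ^ n\<close>; the rest of the integral is nonnegative.\<close>

lemma bergman_test_moment_ge:
  assumes p: "p > 0" and sets: "sets \<mu> = sets (restrict_space borel {0..<1::real})"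
    and fin: "finite_measure \<mu>" and r: "0 < r" "r < 1"
  shows "(1 - r\<^sup>2) powr (-(2 / p)) * measure \<mu> {r..<1} * r ^ n
    \<le> (LINT t|\<mu>. t ^ n * ((1 - r\<^sup>2) powr (2 / p) * (1 - r * t) powr (-(4 / p))))"
proof -
  interpret finite_measure \<mu> by (rule fin)
  have space: "space \<mu> = {0..<1}" by (rule space_unit_interval[OF sets])
  note [measurable] = measurable_ident_unit_interval[OF sets]
  have mset: "{r..<1} \<in> sets \<mu>" using r by (auto simp: sets sets_restrict_space_iff)
  have r2: "0 < 1 - r\<^sup>2" using r by (simp add: power_less_one_iff)
  define \<tau> where "\<tau> = (\<lambda>t. (1 - r\<^sup>2) powr (2 / p) * (1 - r * t) powr (-(4 / p)))"
  have "(1 - r\<^sup>2) powr (-(2 / p)) * measure \<mu> {r..<1} * r ^ n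
     = (LINT t|\<mu>. (1 - r\<^sup>2) powr (-(2 / p)) * r ^ n * indicator {r..<1} t)"
    using mset by (simp add: mult_ac)
  also have "\<dots> \<le> (LINT t|\<mu>. t ^ n * \<tau> t)"
  proof (rule integral_mono')
    show "integrable \<mu> (\<lambda>t. t ^ n * \<tau> t)"
    proof (rule integrable_const_bound[where B = "(1 - r\<^sup>2) powr (2 / p) * (1 - r) powr (-(4 / p))"])
      show "AE t in \<mu>. norm (t ^ n * \<tau> t) \<le> (1 - r\<^sup>2) powr (2 / p) * (1 - r) powr (-(4 / p))"
      proof (intro AE_I2)
        fix t assume "t \<in> space \<mu>"
        then have t: "0 \<le> t" "t < 1" using space by auto
        have "r * t \<le> r * 1" using r t by (intro mult_left_mono) auto
        then have "(1 - r * t) powr (-(4 / p)) \<le> (1 - r) powr (-(4 / p))"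
          using r p by (intro powr_mono2') auto
        then have "t ^ n * \<tau> t \<le> 1 * ((1 - r\<^sup>2) powr (2 / p) * (1 - r) powr (-(4 / p)))"
          unfolding \<tau>_def using t by (intro mult_mono mult_left_mono) (auto simp: power_le_one)
        moreover have "t ^ n * \<tau> t \<ge> 0" using t by (simp add: \<tau>_def)
        ultimately show "norm (t ^ n * \<tau> t) \<le> (1 - r\<^sup>2) powr (2 / p) * (1 - r) powr (-(4 / p))" by simp
      qed
      show "(\<lambda>t. t ^ n * \<tau> t) \<in> borel_measurable \<mu>" unfolding \<tau>_def by measurable
    qed
    fix t assume "t \<in> space \<mu>"
    then have t: "0 \<le> t" "t < 1" using space by auto
    show "0 \<le> t ^ n * \<tau> t" using t by (simp add: \<tau>_def)
    show "(1 - r\<^sup>2) powr (-(2 / p)) * r ^ n * indicator {r..<1} t \<le> t ^ n * \<tau> t"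
    proof (cases "r \<le> t")
      case True
      have "r * t \<le> 1 * t" using r t by (intro mult_right_mono) auto
      then have pos: "0 < 1 - r * t" using t by linarith
      have "r\<^sup>2 \<le> r * t" unfolding power2_eq_square using r True by (intro mult_left_mono) auto
      then have "(1 - r\<^sup>2) powr (-(4 / p)) \<le> (1 - r * t) powr (-(4 / p))"
        using pos p by (intro powr_mono2') auto
      then have "(1 - r\<^sup>2) powr (2 / p) * (1 - r\<^sup>2) powr (-(4 / p)) \<le> \<tau> t"
        unfolding \<tau>_def by (intro mult_left_mono) auto
      moreover have "(1 - r\<^sup>2) powr (2 / p) * (1 - r\<^sup>2) powr (-(4 / p)) = (1 - r\<^sup>2) powr (-(2 / p))"
        by (simp add: field_simps flip: powr_add)
      ultimately have "r ^ n * (1 - r\<^sup>2) powr (-(2 / p)) \<le> t ^ n * \<tau> t"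
        using r t True by (intro mult_mono power_mono) auto
      then show ?thesis using True t by (simp add: mult.commute)
    next
      case False
      then show ?thesis using t by (simp add: \<tau>_def)
    qed
  qed
  finally show ?thesis by (simp add: \<tau>_def)
qed

text \<open>Stated for an arbitrary operator with the common expansion on test functions, so that it applies
  to the Hankel operator and to the integral operator alike. For \<open>r\<close> away from
  \<open>1\<close> the Carleson condition is just finiteness of \<open>\<mu>\<close>.\<close>

lemma carleson_of_bounded:
  assumes p: "p > 0" and \<alpha>: "\<alpha> > -1" and sets: "sets \<mu> = sets (restrict_space borel {0..<1::real})"
    and fin: "finite_measure \<mu>" and bd: "bounded_bergman_bloch p wd T"
    and sums: "\<And>r z. 0 \<le> r \<Longrightarrow> r < 1 \<Longrightarrow> norm z < 1 \<Longrightarrow>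
      (\<lambda>n. complex_of_real (binom_coeff \<alpha> n *
          (LINT t|\<mu>. t ^ n * ((1 - r\<^sup>2) powr (2 / p) * (1 - r * t) powr (-(4 / p))))) * z ^ n)
       sums T (bergman_test p r) z"
  shows "carleson (2 / p + \<alpha> + 1) \<mu>"
proof -
  interpret finite_measure \<mu> by (rule fin)
  define s where "s = 2 / p + \<alpha> + 1"
  have "2 / p > 0" using p by simp
  then have s: "s > 0" using \<alpha> unfolding s_def by linarith
  obtain C where C: "C > 0" "\<And>f. f \<in> bergman p \<Longrightarrow> bloch_norm (T f) \<le> C * bergman_norm p f"
    and bloch: "\<And>f. f \<in> bergman p \<Longrightarrow> T f \<in> bloch"
    using bd unfolding bounded_bergman_bloch_def by blast
  define N where "N = C * (64 * pi) powr (1 / p)"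
  have N: "N > 0" using C(1) by (simp add: N_def)
  have near: "measure \<mu> {r..<1} \<le> (2 * N / (\<alpha> + 1) * 2 powr s) * (1 - r) powr s" if r: "1 / 2 \<le> r" "r < 1" for r
  proof -
    have r0: "0 < r" "0 \<le> r" using r by auto
    have r2: "0 < 1 - r\<^sup>2" using r r0 by (simp add: power_less_one_iff)
    define \<kappa> where "\<kappa> = (1 - r\<^sup>2) powr (-(2 / p)) * measure \<mu> {r..<1}"
    have \<kappa>: "\<kappa> \<ge> 0" by (simp add: \<kappa>_def)
    note test = bergman_test_bound[OF p r]
    have "\<kappa> * (r * (\<alpha> + 1) * (1 - r\<^sup>2) powr (-(\<alpha> + 1))) \<le> bloch_norm (T (bergman_test p r))"
    proof (rule bloch_norm_ge_of_coeffs[OF \<alpha> r0(1) r(2) \<kappa> sums[OF r0(2) r(2)] bloch[OF test(1)]])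
      fix n
      have "binom_coeff \<alpha> n * (\<kappa> * r ^ n) \<le> binom_coeff \<alpha> n *
          (LINT t|\<mu>. t ^ n * ((1 - r\<^sup>2) powr (2 / p) * (1 - r * t) powr (-(4 / p))))"
        unfolding \<kappa>_def using binom_coeff_pos[OF \<alpha>, of n]
        by (intro mult_left_mono bergman_test_moment_ge[OF p sets fin r0(1) r(2)]) auto
      then show "\<kappa> * (binom_coeff \<alpha> n * r ^ n) \<le> binom_coeff \<alpha> n *
          (LINT t|\<mu>. t ^ n * ((1 - r\<^sup>2) powr (2 / p) * (1 - r * t) powr (-(4 / p))))"
        by (simp only: mult.left_commute)
    qed
    also have "\<dots> \<le> C * bergman_norm p (bergman_test p r)" by (rule C(2)[OF test(1)])
    also have "\<dots> \<le> N" unfolding N_def using C(1) test(2) by (intro mult_left_mono) auto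
    finally have "\<kappa> * (r * (\<alpha> + 1) * (1 - r\<^sup>2) powr (-(\<alpha> + 1))) \<le> N" .
    moreover have "\<kappa> * (r * (\<alpha> + 1) * (1 - r\<^sup>2) powr (-(\<alpha> + 1)))
      = (r * (\<alpha> + 1) * measure \<mu> {r..<1}) / (1 - r\<^sup>2) powr s"
    proof -
      have "(1 - r\<^sup>2) powr (-(2 / p)) * (1 - r\<^sup>2) powr (-(\<alpha> + 1)) = (1 - r\<^sup>2) powr (-s)"
      proof -
        have "-(2 / p) + -(\<alpha> + 1) = -s" by (simp add: s_def)
        then show ?thesis
          using powr_add[of "1 - r\<^sup>2" "-(2 / p)" "-(\<alpha> + 1)"] by (simp only:)
      qed
      then have "(1 - r\<^sup>2) powr (-(2 / p)) * (1 - r\<^sup>2) powr (-(\<alpha> + 1)) = 1 / (1 - r\<^sup>2) powr s"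
        by (simp add: powr_minus divide_inverse)
      moreover have "(A * m) * (r * (\<alpha> + 1) * B) = (r * (\<alpha> + 1) * m) * (A * B)" for A m B
        by (simp only: mult_ac)
      ultimately show ?thesis unfolding \<kappa>_def by (simp only: times_divide_eq_right mult_1_right)
    qed
    ultimately have "r * (\<alpha> + 1) * measure \<mu> {r..<1} \<le> N * (1 - r\<^sup>2) powr s"
      using r2 by (simp add: divide_le_eq)
    moreover have "(1 / 2) * ((\<alpha> + 1) * measure \<mu> {r..<1}) \<le> r * ((\<alpha> + 1) * measure \<mu> {r..<1})"
      using r \<alpha> by (intro mult_right_mono) auto
    moreover have "N * (1 - r\<^sup>2) powr s \<le> N * (2 powr s * (1 - r) powr s)"
    proof (intro mult_left_mono)
      have "1 - r\<^sup>2 = (1 + r) * (1 - r)" by (simp add: power2_eq_square algebra_simps)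
      also have "\<dots> \<le> 2 * (1 - r)" using r by (intro mult_right_mono) auto
      finally have "(1 - r\<^sup>2) powr s \<le> (2 * (1 - r)) powr s" using r2 s by (intro powr_mono2) auto
      also have "\<dots> = 2 powr s * (1 - r) powr s" using r by (subst powr_mult) auto
      finally show "(1 - r\<^sup>2) powr s \<le> 2 powr s * (1 - r) powr s" .
    qed (use N in auto)
    ultimately have "(1 / 2) * ((\<alpha> + 1) * measure \<mu> {r..<1}) \<le> N * (2 powr s * (1 - r) powr s)"
      by (simp only: mult.assoc)
    then have "(\<alpha> + 1) * measure \<mu> {r..<1} \<le> 2 * (N * (2 powr s * (1 - r) powr s))" by linarith
    then have "measure \<mu> {r..<1} \<le> 2 * (N * (2 powr s * (1 - r) powr s)) / (\<alpha> + 1)"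
      using \<alpha> by (simp add: le_divide_eq mult.commute)
    then show ?thesis by (simp add: mult.assoc)
  qed
  define M where "M = 2 * N / (\<alpha> + 1) * 2 powr s + measure \<mu> (space \<mu>) * 2 powr s"
  have A: "2 * N / (\<alpha> + 1) * 2 powr s > 0" "measure \<mu> (space \<mu>) * 2 powr s \<ge> 0" using N \<alpha> by auto
  then have M: "M > 0" by (simp add: M_def add_pos_nonneg)
  have "measure \<mu> {t..<1} \<le> M * (1 - t) powr s" if t: "0 \<le> t" "t < 1" for t
  proof (cases "1 / 2 \<le> t")
    case True
    have "measure \<mu> {t..<1} \<le> (2 * N / (\<alpha> + 1) * 2 powr s) * (1 - t) powr s" by (rule near[OF True t(2)])
    also have "\<dots> \<le> M * (1 - t) powr s"
      using A by (intro mult_right_mono) (auto simp: M_def)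
    finally show ?thesis .
  next
    case False
    have "1 = 2 powr s * (1 / 2) powr s" by (simp flip: powr_mult)
    also have "\<dots> \<le> 2 powr s * (1 - t) powr s" using False s by (intro mult_left_mono powr_mono2) auto
    finally have one: "1 \<le> 2 powr s * (1 - t) powr s" .
    have "measure \<mu> {t..<1} \<le> measure \<mu> (space \<mu>) * 1" using bounded_measure by simp
    also have "\<dots> \<le> measure \<mu> (space \<mu>) * (2 powr s * (1 - t) powr s)" using one by (intro mult_left_mono) auto
    also have "\<dots> = (measure \<mu> (space \<mu>) * 2 powr s) * (1 - t) powr s" by (simp only: mult.assoc)
    also have "\<dots> \<le> M * (1 - t) powr s" using A by (intro mult_right_mono) (auto simp: M_def)
    finally show ?thesis .
  qed
  then have "emeasure \<mu> {t..<1} \<le> ennreal (M * (1 - t) powr s)" if "t \<in> {0..<1}" for t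
    using that unfolding emeasure_eq_measure by (intro ennreal_leI) auto
  then show ?thesis using M unfolding carleson_def s_def by blast
qed

theorem theorem4p2:
  fixes p \<alpha> :: real and \<mu> :: "real measure"
  assumes "0 < p" and "\<alpha> > -1"
    and "sets \<mu> = sets (restrict_space borel {0..<1})"
    and "0 < p \<Longrightarrow> p \<le> 1 \<Longrightarrow> carleson (2 / p) \<mu>"
    and "1 \<le> p \<Longrightarrow> p \<le> 2 \<Longrightarrow> carleson ((2 - (p - 1)\<^sup>2) / p) \<mu>"
    and "2 < p \<Longrightarrow> carleson (1 / p) \<mu>"
  shows "(bounded_bergman_bloch p (hankel_well_defined \<mu> \<alpha>) (hankel_op \<mu> \<alpha>) \<longleftrightarrow>
          bounded_bergman_bloch p (integral_well_defined \<mu> \<alpha>) (integral_op \<mu> \<alpha>)) \<and>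
         (bounded_bergman_bloch p (integral_well_defined \<mu> \<alpha>) (integral_op \<mu> \<alpha>) \<longleftrightarrow>
          carleson (2 / p + \<alpha> + 1) \<mu>)"
proof -
  \<comment> \<open>In each range of \<open>p\<close> the a priori exponent is positive; for \<open>1 < p \<le> 2\<close> because \<open>(p - 1)\<^sup>2 \<le> 1\<close>.\<close>
  obtain s where s: "0 < s" "carleson s \<mu>"
  proof (cases "p \<le> 1")
    case True
    then show ?thesis using that[of "2 / p"] assms(1,4) by simp
  next
    case False
    show ?thesis
    proof (cases "p \<le> 2")
      case True
      have "(p - 1)\<^sup>2 \<le> 1\<^sup>2" using False True by (intro power_mono) auto
      then have "0 < (2 - (p - 1)\<^sup>2) / p" using assms(1) by (intro divide_pos_pos) auto
      then show ?thesis using that assms(5) False True by simp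
    next
      case False
      then show ?thesis using that[of "1 / p"] assms(1,6) by simp
    qed
  qed
  have fin: "finite_measure \<mu>" by (rule carleson_finite_measure[OF assms(3) s(2)])
  note suff = carleson_imp_bounded[OF assms(1-3)]
  note sums = bergman_test_sums[OF assms(1-3) s(2,1)]
  have "carleson (2 / p + \<alpha> + 1) \<mu>" if "bounded_bergman_bloch p (hankel_well_defined \<mu> \<alpha>) (hankel_op \<mu> \<alpha>)"
    by (rule carleson_of_bounded[OF assms(1-3) fin that sums(1)])
  moreover have "carleson (2 / p + \<alpha> + 1) \<mu>" if "bounded_bergman_bloch p (integral_well_defined \<mu> \<alpha>) (integral_op \<mu> \<alpha>)"
    by (rule carleson_of_bounded[OF assms(1-3) fin that sums(2)])
  ultimately show ?thesis using suff by blast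
qed

end
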